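(* Let $p=(12,R)$ be a mesh pattern where $R$ is any one of the following twelve sets of shaded cells: $\{(1,2),(2,2),(0,1)\}$, $\{(1,2),(0,1),(0,0)\}$, $\{(2,2),(2,1),(1,0)\}$, $\{(2,1),(1,0),(0,0)\}$, $\{(2,2),(0,1),(1,1)\}$, $\{(1,2),(1,1),(0,0)\}$, $\{(1,1),(2,1),(0,0)\}$, $\{(2,2),(1,1),(1,0)\}$, $\{(1,2),(2,2),(0,0)\}$, $\{(2,2),(0,1),(0,0)\}$, $\{(2,2),(2,1),(0,0)\}$, $\{(2,2),(0,0),(1,0)\}$. Then $s_{n,0}(p)=1$ for all $n\ge 0$, and $s_{0,k}(p)=0$ for all $k\ge 1$. Moreover, for $n>0$ and $k\ge 0$, $$s_{n,k}(p)=n\,s_{n-1,k}(p)-\sum_{h=1}^{n-1}h\, s_{n-1,k,h}(p)+\sum_{h=1}^{n-1}h\, s_{n-1,k-1,h}(p).$$ Here $s_{n,k,h}(p)$ denotes the number of permutations in $\mathfrak S_n$ with exactly $k$ occurrences of $p$ and exactly $h$ admissible positions. These numbers satisfy, for $n\ge 1$ and $k\ge 0$, $$s_{n,k,1}(p)=s_{n,k}(p)-\sum_{h=2}^{n}s_{n,k,h}(p),$$ $$s_{n,k,h}(p)=\sum_{i=1}^{n-1}\sum_{a=0}^{k}s_{i,a,1}(p)\, s_{n-i,k-a,h-1}(p)\quad\text{for } h\ge 2.$$ The initial conditions are $s_{0,0,0}(p)=1$ and $s_{0,k,h}(p)=0$ whenever $(k,h)\ne(0,0)$, while for $n\ge 1$,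 $s_{n,k,h}(p)=0$ whenever $k\notin[0,n-1]$ or $h\notin[1,n]$.
   Context: $\mathfrak S_n$ is the set of permutations of $\{1,\dots,n\}$ in one-line notation $\sigma=\sigma_1\cdots\sigma_n$; $[a,b]$ denotes the set of integers from $a$ to $b$. For $R\subseteq\{0,1,2\}^2$, an occurrence of the mesh pattern $(12,R)$ in $\sigma\in\mathfrak S_n$ is a pair of positions $i_1<i_2$ with $\sigma_{i_1}<\sigma_{i_2}$ such that, setting $i_0=0$, $i_3=n+1$, $v_0=0$, $v_1=\sigma_{i_1}$, $v_2=\sigma_{i_2}$, $v_3=n+1$, for every $(x,y)\in R$ there is no index $\ell$ with $i_x<\ell<i_{x+1}$ and $v_y<\sigma_\ell<v_{y+1}$. $s_{n,k}(p)$ is the number of $\sigma\in\mathfrak S_n$ with exactly $k$ occurrences of $p$. Admissible positions: given $\sigma=\sigma_1\cdots\sigma_n\in\mathfrak S_n$ and $1\le i\le n$, let $\sigma^{(i)}\in\mathfrak S_{n+1}$ be obtained by increasing every letter of $\sigma$ by $1$ and inserting a new letter $1$ immediately to the left of the $i$-th letter. The position $i$ is admissible (for $\sigma$) if $213(\sigma^{(i)})=213(\sigma)$, where $213(\tau)$ is the number of occurrences of the classical pattern $213$ in $\tau$, i.e. the number of triples $x<y<z$ with $\tau_y<\tau_x<\tau_z$. The empty permutation has $0$ admissible positions. *)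

theory Defs
  imports "HOL-Combinatorics.Permutations"
begin

text \<open>
  A permutation of size \<open>n\<close> is a function \<open>\<sigma> :: nat \<Rightarrow> nat\<close> with \<open>\<sigma> permutes {1..n}\<close>; its one-line
  notation is \<open>\<sigma> 1, \<dots>, \<sigma> n\<close>. A mesh pattern \<open>(12, R)\<close> is represented by its set \<open>R\<close> of shaded
  cells, a subset of \<open>{0,1,2} \<times> {0,1,2}\<close>.
\<close>

definition mesh12_occurrences :: "(nat \<times> nat) set \<Rightarrow> nat \<Rightarrow> (nat \<Rightarrow> nat) \<Rightarrow> (nat \<times> nat) set" where
  "mesh12_occurrences R n \<sigma> =
     {(i1, i2). 1 \<le> i1 \<and> i1 < i2 \<and> i2 \<le> n \<and> \<sigma> i1 < \<sigma> i2 \<and>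
        (let i = (\<lambda>x. [0, i1, i2, n + 1] ! x);
             v = (\<lambda>y. [0, \<sigma> i1, \<sigma> i2, n + 1] ! y)
         in \<forall>(x, y) \<in> R. \<not> (\<exists>l. i x < l \<and> l < i (x + 1) \<and> v y < \<sigma> l \<and> \<sigma> l < v (y + 1)))}"

definition occ213 :: "nat \<Rightarrow> (nat \<Rightarrow> nat) \<Rightarrow> nat" where
  "occ213 n \<tau> =
     card {(x, y, z). 1 \<le> x \<and> x < y \<and> y < z \<and> z \<le> n \<and> \<tau> y < \<tau> x \<and> \<tau> x < \<tau> z}"

text \<open>
  \<open>insert_one i \<sigma>\<close> increases every letter of \<open>\<sigma>\<close> by 1 and inserts a new letter 1
  immediately to the left of the \<open>i\<close>-th letter. The clause for \<open>l = 0\<close>, and the last clause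
  beyond position \<open>n + 1\<close>, make it the identity outside \<open>{1..n + 1}\<close>.
\<close>

definition insert_one :: "nat \<Rightarrow> (nat \<Rightarrow> nat) \<Rightarrow> nat \<Rightarrow> nat" where
  "insert_one i \<sigma> l =
     (if l = 0 then 0 else if l < i then \<sigma> l + 1 else if l = i then 1 else \<sigma> (l - 1) + 1)"

lemma insert_one_permutes:
  assumes "\<sigma> permutes {1..n}" and "1 \<le> i" and "i \<le> n + 1"
  shows "insert_one i \<sigma> permutes {1..n + 1}"
proof (rule bij_imp_permutes)
  have inj: "\<sigma> a = \<sigma> b \<longleftrightarrow> a = b" for a b
    using permutes_inj[OF assms(1)] by (auto dest: injD)
  have mem: "1 \<le> \<sigma> a \<and> \<sigma> a \<le> n \<longleftrightarrow> 1 \<le> a \<and> a \<le> n" for a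
    using permutes_in_image[OF assms(1), of a] by simp
  have z: "\<sigma> a = 0 \<longleftrightarrow> a = 0" for a
    using inj[of a 0] permutes_not_in[OF assms(1), of 0] by simp
  have "inj_on (insert_one i \<sigma>) {1..n + 1}"
    unfolding inj_on_def insert_one_def using assms(2) by (auto simp: inj z)
  moreover have "insert_one i \<sigma> l \<in> {1..n + 1}" if "l \<in> {1..n + 1}" for l
    using that assms(2,3) mem[of l] mem[of "l - 1"] unfolding insert_one_def
    by (cases "l < i"; cases "l = i") auto
  then have "insert_one i \<sigma> ` {1..n + 1} \<subseteq> {1..n + 1}"
    by blast
  ultimately show "bij_betw (insert_one i \<sigma>) {1..n + 1} {1..n + 1}"
    by (simp add: bij_betw_def endo_inj_surj)
  show "insert_one i \<sigma> x = x" if "x \<notin> {1..n + 1}" for x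
  proof (cases "x = 0")
    case False
    with that have "x > n + 1" by auto
    then have "\<sigma> (x - 1) = x - 1"
      by (intro permutes_not_in[OF assms(1)]) auto
    then show ?thesis
      using \<open>x > n + 1\<close> assms(3) by (simp add: insert_one_def)
  qed (simp add: insert_one_def)
qed

definition admissible :: "nat \<Rightarrow> (nat \<Rightarrow> nat) \<Rightarrow> nat \<Rightarrow> bool" where
  "admissible n \<sigma> i \<longleftrightarrow> 1 \<le> i \<and> i \<le> n \<and> occ213 (n + 1) (insert_one i \<sigma>) = occ213 n \<sigma>"

text \<open>
  The indices \<open>k\<close> and \<open>h\<close> are integers so that \<open>k - 1\<close> and \<open>h - 1\<close> do not truncate; the numbers
  below vanish at negative \<open>k\<close> or \<open>h\<close>.
\<close>

definition s_occ :: "(nat \<times> nat) set \<Rightarrow> nat \<Rightarrow> int \<Rightarrow> nat" where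
  "s_occ R n k = card {\<sigma>. \<sigma> permutes {1..n} \<and> int (card (mesh12_occurrences R n \<sigma>)) = k}"

definition s_adm :: "(nat \<times> nat) set \<Rightarrow> nat \<Rightarrow> int \<Rightarrow> int \<Rightarrow> nat" where
  "s_adm R n k h =
     card {\<sigma>. \<sigma> permutes {1..n} \<and> int (card (mesh12_occurrences R n \<sigma>)) = k \<and>
              int (card {i. admissible n \<sigma> i}) = h}"

end

theory Submission
  imports Defs
    "HOL-Computational_Algebra.Formal_Power_Series"
    "HOL-Computational_Algebra.Polynomial"
begin

text \<open>
  A position \<open>i\<close> is admissible exactly when every letter to the left of it is larger than every
  letter from it onwards, that is, when a component of the skew-sum decomposition of \<open>\<sigma>\<close>
  starts there. So the number of admissible positions is the number of skew components,
  \<open>components n \<sigma>\<close>. For the twelve patterns neither corner cell \<open>(0,2)\<close>, \<open>(2,0)\<close> is shaded,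
  and both letters of an occurrence lie in one component, so the number of occurrences is additive
  over skew sums. Splitting off the first component gives the convolution formula for \<open>s_adm\<close>.

  What remains is the recurrence for \<open>s_occ\<close>. Write \<open>F n\<close> for the sum of \<open>q ^ st \<sigma>\<close> over the
  permutations of size \<open>n\<close>, where \<open>st\<close> counts occurrences; it has to be shown that
  \<open>F (n + 1) = (n + 1) F n + (q - 1) \<Sum> components \<sigma> * q ^ st \<sigma>\<close>
  (\<open>component_recurrence\<close>). Inverse and reverse-complement preserve the number of components and
  reflect, respectively rotate, the shaded cells; under them the twelve sets form three orbits of
  size four, and one representative of each is enough.

  \<^item> For \<open>{(1,2), (2,2), (0,1)}\<close> an occurrence is determined by its first position.
    Inserting a new smallest letter at position \<open>a\<close> keeps all occurrences and creates exactly one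
    more if \<open>a\<close> is admissible, none otherwise (\<open>card_unobstructed_climbs_insert_one\<close>), which is the
    recurrence.

  \<^item> For \<open>{(2,2), (0,1), (1,1)}\<close> and \<open>{(2,2), (0,0), (1,0)}\<close> an occurrence is
    determined by its second position, and \<open>st\<close> is the number of right-to-left maxima that are not
    components of size one. Insertion of a new letter does not change this number by the right amount
    one permutation at a time, so the recurrence is proved by generating functions. The number of all
    right-to-left maxima has an easy recurrence, \<open>G (n + 1) = (n + q) G n\<close>, and on permutations
    with a single component the two statistics differ only for the permutation of size one. As
    \<open>F = 1 / (1 - I)\<close> for the series \<open>I\<close> of one-component permutations,
    this gives \<open>1 / G = 1 / F - (q - 1) x\<close>, and the substitution turns the linear differential
    equation of \<open>G\<close> into the Riccati equation
    \<open>F = 1 + x F + x^2 F' + (q - 1) x (F^2 - F)\<close> (\<open>riccati_transfer\<close>). The coefficients of \<open>F^2\<close>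
    count permutations with a marked skew cut, hence \<open>F^2 - F\<close> counts components and the
    Riccati equation is the recurrence.
\<close>

section \<open>Skew cuts and admissible positions\<close>

abbreviation perms :: "nat \<Rightarrow> (nat \<Rightarrow> nat) set" where
  "perms n \<equiv> {\<sigma>. \<sigma> permutes {1..n}}"

lemma perms_inj: "\<sigma> \<in> perms n \<Longrightarrow> \<sigma> a = \<sigma> b \<longleftrightarrow> a = b"
  using permutes_inj[of \<sigma>] by (auto dest: injD)

lemma perms_range: "\<sigma> \<in> perms n \<Longrightarrow> 1 \<le> \<sigma> a \<and> \<sigma> a \<le> n \<longleftrightarrow> 1 \<le> a \<and> a \<le> n"
  using permutes_in_image[of \<sigma> "{1..n}" a] by simp

lemma finite_perms [simp]: "finite (perms n)"
  by (simp add: finite_permutations)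

lemmas finite_perms_Suc_0 [simp] = finite_perms[unfolded One_nat_def]

lemma perms_0 [simp]: "perms 0 = {id}"
  by simp

text \<open>
  Both trivial cuts \<open>0\<close> and \<open>n\<close> are allowed, so a permutation with \<open>h\<close> components has
  \<open>h + 1\<close> skew cuts; counting only the cuts below \<open>n\<close> counts the components by their left ends.
\<close>

definition skew_cut :: "nat \<Rightarrow> (nat \<Rightarrow> nat) \<Rightarrow> nat \<Rightarrow> bool" where
  "skew_cut n \<sigma> c \<longleftrightarrow> c \<le> n \<and> (\<forall>x y. 1 \<le> x \<longrightarrow> x \<le> c \<longrightarrow> c < y \<longrightarrow> y \<le> n \<longrightarrow> \<sigma> y < \<sigma> x)"

definition components :: "nat \<Rightarrow> (nat \<Rightarrow> nat) \<Rightarrow> nat" where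
  "components n \<sigma> = card {c. c < n \<and> skew_cut n \<sigma> c}"

lemma skew_cut_0 [simp]: "skew_cut n \<sigma> 0"
  by (simp add: skew_cut_def)

lemma skew_cut_size [simp]: "skew_cut n \<sigma> n"
  by (simp add: skew_cut_def)

lemma skew_cut_le: "skew_cut n \<sigma> c \<Longrightarrow> c \<le> n"
  by (simp add: skew_cut_def)

lemma card_skew_cuts: "card {c. skew_cut n \<sigma> c} = Suc (components n \<sigma>)"
proof -
  have "{c. skew_cut n \<sigma> c} = insert n {c. c < n \<and> skew_cut n \<sigma> c}"
    by (auto dest: skew_cut_le simp: order_le_less)
  then show ?thesis
    by (simp add: components_def)
qed

lemma components_0 [simp]: "components 0 \<sigma> = 0"
  by (simp add: components_def)

lemma components_le: "components n \<sigma> \<le> n"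
proof -
  have "card {c. c < n \<and> skew_cut n \<sigma> c} \<le> card {..<n}"
    by (rule card_mono) auto
  then show ?thesis by (simp add: components_def)
qed

lemma components_pos: "n \<ge> 1 \<Longrightarrow> components n \<sigma> \<ge> 1"
proof -
  assume "n \<ge> 1"
  then have "0 \<in> {c. c < n \<and> skew_cut n \<sigma> c}" by simp
  then have "{c. c < n \<and> skew_cut n \<sigma> c} \<noteq> {}" by blast
  then have "card {c. c < n \<and> skew_cut n \<sigma> c} \<noteq> 0"
    by (subst card_0_eq) auto
  then show ?thesis unfolding components_def by linarith
qed

text \<open>
  The position in \<open>insert_one i \<sigma>\<close> of the letter that stood at position \<open>l\<close> of \<open>\<sigma>\<close>.
\<close>

definition shift :: "nat \<Rightarrow> nat \<Rightarrow> nat" where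
  "shift i l = (if l < i then l else l + 1)"

lemma shift_less_iff [simp]: "shift i x < shift i y \<longleftrightarrow> x < y"
  by (auto simp: shift_def)

lemma shift_eq_iff [simp]: "shift i x = shift i y \<longleftrightarrow> x = y"
  by (auto simp: shift_def)

lemma shift_neq [simp]: "shift i x \<noteq> i" "i \<noteq> shift i x"
  by (auto simp: shift_def)

lemma shift_ge_1_iff: "1 \<le> i \<Longrightarrow> 1 \<le> shift i x \<longleftrightarrow> 1 \<le> x"
  by (auto simp: shift_def)

lemma shift_le_iff: "i \<le> n + 1 \<Longrightarrow> shift i x \<le> n + 1 \<longleftrightarrow> x \<le> n"
  by (auto simp: shift_def)

lemma shift_surj: "l \<noteq> i \<Longrightarrow> \<exists>x. l = shift i x"
  by (rule exI[of _ "if l < i then l else l - 1"]) (auto simp: shift_def)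

lemma insert_one_shift: "1 \<le> i \<Longrightarrow> 1 \<le> l \<Longrightarrow> insert_one i \<sigma> (shift i l) = \<sigma> l + 1"
  by (simp add: shift_def insert_one_def)

lemma insert_one_self: "1 \<le> i \<Longrightarrow> insert_one i \<sigma> i = 1"
  by (simp add: insert_one_def)

text \<open>
  The old letters keep their 213-patterns. The new smallest letter can only play the role of the
  1 in a new one, and then the 2 is to its left, the 3 to its right.
\<close>

lemma occ213_insert_one:
  assumes \<sigma>: "\<sigma> \<in> perms n" and i: "1 \<le> i" "i \<le> n + 1"
  shows "occ213 (n + 1) (insert_one i \<sigma>) =
    occ213 n \<sigma> + card {(x, z). 1 \<le> x \<and> x < i \<and> i \<le> z \<and> z \<le> n \<and> \<sigma> x < \<sigma> z}"
proof -
  let ?\<tau> = "insert_one i \<sigma>"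
  let ?A = "{(x, y, z). 1 \<le> x \<and> x < y \<and> y < z \<and> z \<le> n \<and> \<sigma> y < \<sigma> x \<and> \<sigma> x < \<sigma> z}"
  let ?B = "{(x, z). 1 \<le> x \<and> x < i \<and> i \<le> z \<and> z \<le> n \<and> \<sigma> x < \<sigma> z}"
  let ?f = "\<lambda>(x, y, z). (shift i x, shift i y, shift i z)"
  let ?g = "\<lambda>(x, z). (shift i x, i, shift i z)"
  let ?C = "{(x, y, z). 1 \<le> x \<and> x < y \<and> y < z \<and> z \<le> n + 1 \<and> ?\<tau> y < ?\<tau> x \<and> ?\<tau> x < ?\<tau> z}"
  have pos: "\<sigma> l \<ge> 1" if "1 \<le> l" "l \<le> n" for l
    using perms_range[OF \<sigma>, of l] that by auto
  have fin: "finite ?A"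
    by (rule finite_subset[of _ "{..n} \<times> {..n} \<times> {..n}"]) auto
  have finB: "finite ?B"
    by (rule finite_subset[of _ "{..n} \<times> {..n}"]) auto
  have val: "?\<tau> (shift i l) = \<sigma> l + 1" if "1 \<le> l" for l
    by (rule insert_one_shift[OF i(1) that])
  have old: "(shift i x, shift i y, shift i z) \<in> ?C \<longleftrightarrow> (x, y, z) \<in> ?A" for x y z
  proof (cases "1 \<le> x \<and> x < y \<and> y < z \<and> z \<le> n")
    case True
    then have "1 \<le> x" "1 \<le> y" "1 \<le> z" by linarith+
    then show ?thesis
      by (simp only: mem_Collect_eq split_conv shift_ge_1_iff[OF i(1)] shift_le_iff[OF i(2)]
          shift_less_iff val add_less_cancel_right)
  next
    case False
    then show ?thesis
      by (simp only: mem_Collect_eq split_conv shift_ge_1_iff[OF i(1)] shift_le_iff[OF i(2)]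
          shift_less_iff) blast
  qed
  have sh: "shift i x < i \<longleftrightarrow> x < i" "i < shift i x \<longleftrightarrow> i \<le> x" for x
    by (auto simp: shift_def)
  have new: "(shift i x, i, shift i z) \<in> ?C \<longleftrightarrow> (x, z) \<in> ?B" for x z
  proof (cases "1 \<le> x \<and> x < i \<and> i \<le> z \<and> z \<le> n")
    case True
    then have "1 \<le> x" "1 \<le> z" "0 < \<sigma> x" using pos[of x] i by linarith+
    then show ?thesis
      using insert_one_self[OF i(1), of \<sigma>]
      by (simp add: shift_ge_1_iff[OF i(1), simplified] shift_le_iff[OF i(2), simplified] sh val)
  next
    case False
    then show ?thesis
      by (simp only: mem_Collect_eq split_conv shift_ge_1_iff[OF i(1)] shift_le_iff[OF i(2)]
          sh) blast
  qed
  have C: "?C = ?f ` ?A \<union> ?g ` ?B"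
  proof
    show "?f ` ?A \<union> ?g ` ?B \<subseteq> ?C"
      using old new by fast
    show "?C \<subseteq> ?f ` ?A \<union> ?g ` ?B"
    proof
      fix t assume t: "t \<in> ?C"
      obtain x y z where xyz: "t = (x, y, z)" by (cases t)
      have "?\<tau> x > 1" "?\<tau> z > 1" if "y \<noteq> 0"
        using t xyz that by (auto simp: insert_one_def split: if_splits)
      then have "x \<noteq> i" "z \<noteq> i"
        using t xyz i by (auto simp: insert_one_self)
      then obtain x' z' where xz: "x = shift i x'" "z = shift i z'"
        using shift_surj by blast
      show "t \<in> ?f ` ?A \<union> ?g ` ?B"
      proof (cases "y = i")
        case True
        then have "t = ?g (x', z')" "(x', z') \<in> ?B"
          using t new[of x' z'] by (simp_all add: xyz xz)
        then show ?thesis by blast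
      next
        case False
        then obtain y' where "y = shift i y'"
          using shift_surj by blast
        then have "t = ?f (x', y', z')" "(x', y', z') \<in> ?A"
          using t old[of x' y' z'] by (simp_all only: xyz xz split_conv)
        then show ?thesis by blast
      qed
    qed
  qed
  have "inj_on ?f ?A" "inj_on ?g ?B"
    by (auto simp: inj_on_def)
  moreover have "?f ` ?A \<inter> ?g ` ?B = {}"
    by auto
  ultimately show ?thesis
    unfolding occ213_def C using fin finB by (simp only: card_Un_disjoint card_image finite_imageI)
qed

lemma admissible_iff_skew_cut:
  assumes \<sigma>: "\<sigma> \<in> perms n"
  shows "admissible n \<sigma> i \<longleftrightarrow> 1 \<le> i \<and> i \<le> n \<and> skew_cut n \<sigma> (i - 1)"
proof (cases "1 \<le> i \<and> i \<le> n")
  case True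
  let ?B = "{(x, z). 1 \<le> x \<and> x < i \<and> i \<le> z \<and> z \<le> n \<and> \<sigma> x < \<sigma> z}"
  have "finite ?B"
    by (rule finite_subset[of _ "{..n} \<times> {..n}"]) auto
  then have "admissible n \<sigma> i \<longleftrightarrow> ?B = {}"
    using True occ213_insert_one[OF \<sigma>, of i] by (simp add: admissible_def)
  also have "\<dots> \<longleftrightarrow> (\<forall>x z. 1 \<le> x \<longrightarrow> x < i \<longrightarrow> i \<le> z \<longrightarrow> z \<le> n \<longrightarrow> \<not> \<sigma> x < \<sigma> z)"
    by blast
  also have "\<dots> \<longleftrightarrow> (\<forall>x z. 1 \<le> x \<longrightarrow> x < i \<longrightarrow> i \<le> z \<longrightarrow> z \<le> n \<longrightarrow> \<sigma> z < \<sigma> x)"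
  proof -
    have "\<not> \<sigma> x < \<sigma> z \<longleftrightarrow> \<sigma> z < \<sigma> x" if "x < i" "i \<le> z" for x z
      using perms_inj[OF \<sigma>, of x z] that by auto
    then show ?thesis by blast
  qed
  also have "\<dots> \<longleftrightarrow> skew_cut n \<sigma> (i - 1)"
  proof -
    obtain c where "i = Suc c" "c < n"
      using True by (cases i) auto
    then show ?thesis
      by (simp add: skew_cut_def less_Suc_eq_le Suc_le_eq order_less_imp_le)
  qed
  finally show ?thesis using True by blast
qed (auto simp: admissible_def)

lemma card_admissible:
  assumes "\<sigma> \<in> perms n"
  shows "card {i. admissible n \<sigma> i} = components n \<sigma>"
proof -
  have "{i. admissible n \<sigma> i} = Suc ` {c. c < n \<and> skew_cut n \<sigma> c}"
  proof (intro set_eqI)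
    fix i show "i \<in> {i. admissible n \<sigma> i} \<longleftrightarrow> i \<in> Suc ` {c. c < n \<and> skew_cut n \<sigma> c}"
      unfolding mem_Collect_eq admissible_iff_skew_cut[OF assms] by (cases i) auto
  qed
  then show ?thesis by (simp add: components_def card_image)
qed

section \<open>Inserting a new smallest letter\<close>

lemma perms_0_0: "\<sigma> \<in> perms n \<Longrightarrow> \<sigma> 0 = 0"
  by (rule permutes_not_in[of \<sigma> "{1..n}"]) auto

lemma permsI:
  assumes "inj_on \<sigma> {1..n}" "\<And>x. 1 \<le> x \<Longrightarrow> x \<le> n \<Longrightarrow> 1 \<le> \<sigma> x \<and> \<sigma> x \<le> n"
    and "\<And>x. x = 0 \<or> n < x \<Longrightarrow> \<sigma> x = x"
  shows "\<sigma> \<in> perms n"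
proof -
  have "\<sigma> ` {1..n} \<subseteq> {1..n}" using assms(2) by auto
  then have "bij_betw \<sigma> {1..n} {1..n}"
    using assms(1) by (simp add: bij_betw_def endo_inj_surj)
  then show ?thesis
    using assms(3) by (auto intro!: bij_imp_permutes simp: not_le)
qed

text \<open>
  The position of the letter 1 recovers \<open>i\<close>, and then \<open>\<sigma>\<close>; surjectivity follows by comparing
  cardinalities.
\<close>

lemma insert_one_bij:
  "bij_betw (\<lambda>(i, \<sigma>). insert_one i \<sigma>) ({1..n + 1} \<times> perms n) (perms (n + 1))"
proof -
  let ?f = "\<lambda>(i, \<sigma>). insert_one i \<sigma>"
  have pos: "\<sigma> l \<noteq> 0" if "\<sigma> \<in> perms n" "1 \<le> l" for \<sigma> l
    using perms_inj[OF that(1), of l 0] perms_0_0[OF that(1)] that by simp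
  have one: "insert_one i \<sigma> l = 1 \<longleftrightarrow> l = i" if "\<sigma> \<in> perms n" "1 \<le> i" for i \<sigma> l
    using that pos[OF that(1), of l] pos[OF that(1), of "l - 1"]
    by (cases "l = 0"; cases "l < i"; cases "l = i") (simp_all add: insert_one_def)
  have inj: "inj_on ?f ({1..n + 1} \<times> perms n)"
  proof (rule inj_onI, clarify)
    fix i \<sigma> j \<rho>
    assume h: "i \<in> {1..n + 1}" "j \<in> {1..n + 1}" "\<sigma> permutes {1..n}" "\<rho> permutes {1..n}"
      and eq: "insert_one i \<sigma> = insert_one j \<rho>"
    have "insert_one j \<rho> i = 1"
      using insert_one_self[of i \<sigma>] h eq by simp
    then have ij: "i = j"
      using one[of \<rho> j i] h by auto
    have "\<sigma> l = \<rho> l" for l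
    proof (cases "l = 0")
      case True
      then show ?thesis using perms_0_0[of \<sigma> n] perms_0_0[of \<rho> n] h by simp
    next
      case False
      have "insert_one i \<sigma> (shift i l) = insert_one i \<rho> (shift i l)"
        using eq ij by simp
      moreover have "insert_one i \<sigma> (shift i l) = \<sigma> l + 1" "insert_one i \<rho> (shift i l) = \<rho> l + 1"
        using False h(1) by (simp_all add: insert_one_shift)
      ultimately show ?thesis by simp
    qed
    then show "i = j \<and> \<sigma> = \<rho>" using ij by auto
  qed
  have sub: "?f ` ({1..n + 1} \<times> perms n) \<subseteq> perms (n + 1)"
    by (auto intro!: insert_one_permutes[simplified])
  have "card (?f ` ({1..n + 1} \<times> perms n)) = card (perms (n + 1))"
    by (simp only: card_image[OF inj] card_cartesian_product card_permutations[OF refl finite_atLeastAtMost])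
      simp
  then have "?f ` ({1..n + 1} \<times> perms n) = perms (n + 1)"
    by (intro card_subset_eq[OF finite_perms sub])
  with inj show ?thesis by (simp add: bij_betw_def)
qed

section \<open>Skew sums\<close>

text \<open>
  The letters to the left of a cut at \<open>c\<close> are the \<open>c\<close> largest ones. This form is symmetric between
  positions and values, which makes it usable both for splitting a permutation at a cut and for
  passing to the inverse.
\<close>

lemma skew_cut_iff:
  assumes \<sigma>: "\<sigma> \<in> perms n" and c: "c \<le> n"
  shows "skew_cut n \<sigma> c \<longleftrightarrow> (\<forall>x. 1 \<le> x \<longrightarrow> x \<le> n \<longrightarrow> x \<le> c \<longleftrightarrow> n - c < \<sigma> x)"
proof
  assume cut: "skew_cut n \<sigma> c"
  have inj: "inj_on \<sigma> A" for A
    using perms_inj[OF \<sigma>] by (auto simp: inj_on_def)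
  show "\<forall>x. 1 \<le> x \<longrightarrow> x \<le> n \<longrightarrow> x \<le> c \<longleftrightarrow> n - c < \<sigma> x"
  proof (intro allI impI)
    fix x assume x: "1 \<le> x" "x \<le> n"
    show "x \<le> c \<longleftrightarrow> n - c < \<sigma> x"
    proof (cases "x \<le> c")
      case True
      have "\<sigma> ` {c + 1..n} \<subseteq> {1..<\<sigma> x}"
      proof
        fix v assume "v \<in> \<sigma> ` {c + 1..n}"
        then obtain y where y: "v = \<sigma> y" "c < y" "y \<le> n" by auto
        have "\<sigma> y < \<sigma> x" using cut x True y by (simp add: skew_cut_def)
        moreover have "1 \<le> \<sigma> y" using perms_range[OF \<sigma>, of y] y by simp
        ultimately show "v \<in> {1..<\<sigma> x}" using y by simp
      qed
      then have "card (\<sigma> ` {c + 1..n}) \<le> card {1..<\<sigma> x}"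
        by (intro card_mono) auto
      then have "n - c \<le> \<sigma> x - 1"
        by (simp add: card_image[OF inj])
      moreover have "1 \<le> \<sigma> x" using perms_range[OF \<sigma>, of x] x by simp
      ultimately show ?thesis using True by simp
    next
      case False
      have "\<sigma> ` {1..c} \<subseteq> {\<sigma> x + 1..n}"
      proof
        fix v assume "v \<in> \<sigma> ` {1..c}"
        then obtain y where y: "v = \<sigma> y" "1 \<le> y" "y \<le> c" by auto
        have "\<sigma> x < \<sigma> y" using cut x False y by (simp add: skew_cut_def)
        moreover have "\<sigma> y \<le> n" using perms_range[OF \<sigma>, of y] y c by simp
        ultimately show "v \<in> {\<sigma> x + 1..n}" using y by simp
      qed
      then have "card (\<sigma> ` {1..c}) \<le> card {\<sigma> x + 1..n}"
        by (intro card_mono) auto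
      then have "c \<le> n - \<sigma> x"
        by (simp add: card_image[OF inj])
      moreover have "\<sigma> x \<le> n" using perms_range[OF \<sigma>, of x] x by simp
      ultimately show ?thesis using False c by simp
    qed
  qed
next
  assume h: "\<forall>x. 1 \<le> x \<longrightarrow> x \<le> n \<longrightarrow> x \<le> c \<longleftrightarrow> n - c < \<sigma> x"
  show "skew_cut n \<sigma> c"
    unfolding skew_cut_def
  proof (intro conjI c allI impI)
    fix x y assume "1 \<le> x" "x \<le> c" "c < y" "y \<le> n"
    then have "n - c < \<sigma> x" "\<not> n - c < \<sigma> y"
      using h[rule_format, of x] h[rule_format, of y] c by auto
    then show "\<sigma> y < \<sigma> x" by simp
  qed
qed

definition skew_sum :: "nat \<Rightarrow> nat \<Rightarrow> (nat \<Rightarrow> nat) \<Rightarrow> (nat \<Rightarrow> nat) \<Rightarrow> nat \<Rightarrow> nat" where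
  "skew_sum i m \<sigma> \<rho> l =
     (if l = 0 \<or> i + m < l then l else if l \<le> i then m + \<sigma> l else \<rho> (l - i))"

lemma skew_sum_left: "1 \<le> l \<Longrightarrow> l \<le> i \<Longrightarrow> skew_sum i m \<sigma> \<rho> l = m + \<sigma> l"
  by (simp add: skew_sum_def)

lemma skew_sum_right: "1 \<le> l \<Longrightarrow> l \<le> m \<Longrightarrow> skew_sum i m \<sigma> \<rho> (i + l) = \<rho> l"
  by (simp add: skew_sum_def)

lemma skew_sum_perms:
  assumes "\<sigma> \<in> perms i" "\<rho> \<in> perms m"
  shows "skew_sum i m \<sigma> \<rho> \<in> perms (i + m)"
proof -
  have l: "m < skew_sum i m \<sigma> \<rho> x \<and> skew_sum i m \<sigma> \<rho> x \<le> i + m" if "1 \<le> x" "x \<le> i" for x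
    using perms_range[OF assms(1), of x] that by (auto simp: skew_sum_left)
  have r: "1 \<le> skew_sum i m \<sigma> \<rho> x \<and> skew_sum i m \<sigma> \<rho> x \<le> m" if "i < x" "x \<le> i + m" for x
    using perms_range[OF assms(2), of "x - i"] that by (auto simp: skew_sum_def)
  show ?thesis
  proof (rule permsI)
    show "inj_on (skew_sum i m \<sigma> \<rho>) {1..i + m}"
    proof (rule inj_onI)
      fix x y assume xy: "x \<in> {1..i + m}" "y \<in> {1..i + m}"
        and eq: "skew_sum i m \<sigma> \<rho> x = skew_sum i m \<sigma> \<rho> y"
      show "x = y"
      proof (cases "x \<le> i")
        case True
        then have "y \<le> i" using l[of x] r[of y] xy eq by fastforce
        then show ?thesis
          using True xy eq perms_inj[OF assms(1)] by (simp add: skew_sum_left)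
      next
        case False
        then have "\<not> y \<le> i" using l[of y] r[of x] xy eq by fastforce
        then have "\<rho> (x - i) = \<rho> (y - i)" using False xy eq by (simp add: skew_sum_def)
        then have "x - i = y - i" using perms_inj[OF assms(2)] by simp
        then show ?thesis using False \<open>\<not> y \<le> i\<close> by simp
      qed
    qed
    show "1 \<le> skew_sum i m \<sigma> \<rho> x \<and> skew_sum i m \<sigma> \<rho> x \<le> i + m" if "1 \<le> x" "x \<le> i + m" for x
      using l[of x] r[of x] that by (cases "x \<le> i") auto
  qed (auto simp: skew_sum_def)
qed

lemma skew_cut_skew_sum:
  assumes "\<sigma> \<in> perms i" "\<rho> \<in> perms m"
  shows "skew_cut (i + m) (skew_sum i m \<sigma> \<rho>) c \<longleftrightarrow>
    (c \<le> i \<and> skew_cut i \<sigma> c) \<or> (i \<le> c \<and> skew_cut m \<rho> (c - i))"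
proof -
  let ?\<tau> = "skew_sum i m \<sigma> \<rho>"
  have l: "m < ?\<tau> x" if "1 \<le> x" "x \<le> i" for x
    using perms_range[OF assms(1), of x] that by (auto simp: skew_sum_left)
  have r: "?\<tau> x \<le> m" if "i < x" "x \<le> i + m" for x
    using perms_range[OF assms(2), of "x - i"] that by (auto simp: skew_sum_def)
  consider "c \<le> i" | "i < c" by linarith
  then show ?thesis
  proof cases
    case 1
    have "skew_cut (i + m) ?\<tau> c \<longleftrightarrow> skew_cut i \<sigma> c"
    proof
      assume h: "skew_cut (i + m) ?\<tau> c"
      have "\<sigma> y < \<sigma> x" if "1 \<le> x" "x \<le> c" "c < y" "y \<le> i" for x y
      proof -
        have "?\<tau> y < ?\<tau> x" using h that by (auto simp: skew_cut_def)
        then show ?thesis using that 1 by (simp add: skew_sum_left)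
      qed
      then show "skew_cut i \<sigma> c" using 1 by (auto simp: skew_cut_def)
    next
      assume h: "skew_cut i \<sigma> c"
      have "?\<tau> y < ?\<tau> x" if "1 \<le> x" "x \<le> c" "c < y" "y \<le> i + m" for x y
      proof (cases "y \<le> i")
        case True
        then have "\<sigma> y < \<sigma> x" using h that by (auto simp: skew_cut_def)
        then show ?thesis using that True 1 by (simp add: skew_sum_left)
      next
        case False
        then show ?thesis using l[of x] r[of y] that 1 by fastforce
      qed
      then show "skew_cut (i + m) ?\<tau> c" using 1 by (auto simp: skew_cut_def)
    qed
    then show ?thesis
      using 1 by (cases "c = i") auto
  next
    case 2
    have "skew_cut (i + m) ?\<tau> c \<longleftrightarrow> skew_cut m \<rho> (c - i)"
    proof
      assume h: "skew_cut (i + m) ?\<tau> c"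
      have "\<rho> y < \<rho> x" if "1 \<le> x" "x \<le> c - i" "c - i < y" "y \<le> m" for x y
      proof -
        have "1 \<le> i + x" "i + x \<le> c" "c < i + y" "i + y \<le> i + m" using that 2 by linarith+
        then have "?\<tau> (i + y) < ?\<tau> (i + x)" using h by (auto simp: skew_cut_def)
        moreover have "1 \<le> y" "x \<le> m" using that by linarith+
        ultimately show ?thesis using that by (simp add: skew_sum_right)
      qed
      moreover have "c - i \<le> m" using h by (auto simp: skew_cut_def)
      ultimately show "skew_cut m \<rho> (c - i)" by (auto simp: skew_cut_def)
    next
      assume h: "skew_cut m \<rho> (c - i)"
      have "?\<tau> y < ?\<tau> x" if "1 \<le> x" "x \<le> c" "c < y" "y \<le> i + m" for x y
      proof (cases "x \<le> i")
        case True
        then show ?thesis using l[of x] r[of y] that 2 by fastforce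
      next
        case False
        have "1 \<le> x - i" "x - i \<le> c - i" "c - i < y - i" "y - i \<le> m"
          using False that 2 by linarith+
        then have "\<rho> (y - i) < \<rho> (x - i)" using h by (auto simp: skew_cut_def)
        then show ?thesis using that False 2 by (simp add: skew_sum_def)
      qed
      then show "skew_cut (i + m) ?\<tau> c" using 2 h by (auto simp: skew_cut_def)
    qed
    then show ?thesis using 2 by auto
  qed
qed

lemma components_skew_sum:
  assumes "\<sigma> \<in> perms i" "\<rho> \<in> perms m"
  shows "components (i + m) (skew_sum i m \<sigma> \<rho>) = components i \<sigma> + components m \<rho>"
proof -
  let ?A = "{c. c < i \<and> skew_cut i \<sigma> c}" and ?B = "{c. c < m \<and> skew_cut m \<rho> c}"
  have "{c. c < i + m \<and> skew_cut (i + m) (skew_sum i m \<sigma> \<rho>) c} = ?A \<union> (+) i ` ?B"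
  proof (intro set_eqI)
    fix c
    show "c \<in> {c. c < i + m \<and> skew_cut (i + m) (skew_sum i m \<sigma> \<rho>) c} \<longleftrightarrow> c \<in> ?A \<union> (+) i ` ?B"
    proof (cases "c < i")
      case True
      then show ?thesis by (auto simp: skew_cut_skew_sum[OF assms])
    next
      case False
      then obtain d where "c = i + d" by (metis le_iff_add not_le)
      then show ?thesis by (auto simp: skew_cut_skew_sum[OF assms])
    qed
  qed
  moreover have "card (?A \<union> (+) i ` ?B) = card ?A + card ?B"
    by (subst card_Un_disjoint) (auto simp: card_image)
  ultimately show ?thesis by (simp add: components_def)
qed

text \<open>
  A permutation with a skew cut at \<open>i\<close> is the skew sum, in one way, of its restrictions to the
  first \<open>i\<close> and to the last \<open>m\<close> positions.
\<close>

lemma skew_sum_bij: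
  "bij_betw (\<lambda>(\<sigma>, \<rho>). skew_sum i m \<sigma> \<rho>) (perms i \<times> perms m)
    {\<tau> \<in> perms (i + m). skew_cut (i + m) \<tau> i}"
proof -
  let ?f = "\<lambda>(\<sigma>, \<rho>). skew_sum i m \<sigma> \<rho>"
  have "inj_on ?f (perms i \<times> perms m)"
  proof (rule inj_onI)
    fix p q assume pq: "p \<in> perms i \<times> perms m" "q \<in> perms i \<times> perms m" and eq: "?f p = ?f q"
    obtain \<sigma> \<rho> \<sigma>' \<rho>' where p: "p = (\<sigma>, \<rho>)" "q = (\<sigma>', \<rho>')"
      by (cases p, cases q)
    have perms: "\<sigma> permutes {1..i}" "\<sigma>' permutes {1..i}" "\<rho> permutes {1..m}" "\<rho>' permutes {1..m}"
      using pq p by auto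
    have eq': "skew_sum i m \<sigma> \<rho> l = skew_sum i m \<sigma>' \<rho>' l" for l
      using eq p by simp
    have "\<sigma> l = \<sigma>' l" for l
    proof (cases "l \<in> {1..i}")
      case True
      then show ?thesis using eq'[of l] by (simp add: skew_sum_left)
    next
      case False
      then show ?thesis using permutes_not_in[OF perms(1)] permutes_not_in[OF perms(2)] by metis
    qed
    moreover have "\<rho> l = \<rho>' l" for l
    proof (cases "l \<in> {1..m}")
      case True
      then show ?thesis using eq'[of "i + l"] by (simp add: skew_sum_right)
    next
      case False
      then show ?thesis using permutes_not_in[OF perms(3)] permutes_not_in[OF perms(4)] by metis
    qed
    ultimately show "p = q" using p by auto
  qed
  moreover have "?f ` (perms i \<times> perms m) = {\<tau> \<in> perms (i + m). skew_cut (i + m) \<tau> i}"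
  proof
    show "?f ` (perms i \<times> perms m) \<subseteq> {\<tau> \<in> perms (i + m). skew_cut (i + m) \<tau> i}"
      using skew_sum_perms skew_cut_skew_sum by fastforce
    show "{\<tau> \<in> perms (i + m). skew_cut (i + m) \<tau> i} \<subseteq> ?f ` (perms i \<times> perms m)"
    proof
      fix \<tau> assume t: "\<tau> \<in> {\<tau> \<in> perms (i + m). skew_cut (i + m) \<tau> i}"
      then have \<tau>: "\<tau> \<in> perms (i + m)" by blast
      have cut: "x \<le> i \<longleftrightarrow> m < \<tau> x" if "1 \<le> x" "x \<le> i + m" for x
        using skew_cut_iff[OF \<tau>, of i] t that by simp
      define \<sigma> where "\<sigma> l = (if 1 \<le> l \<and> l \<le> i then \<tau> l - m else l)" for l
      define \<rho> where "\<rho> l = (if 1 \<le> l \<and> l \<le> m then \<tau> (i + l) else l)" for l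
      have "\<sigma> \<in> perms i"
      proof (rule permsI)
        show "inj_on \<sigma> {1..i}"
        proof (rule inj_onI)
          fix x y assume xy: "x \<in> {1..i}" "y \<in> {1..i}" and "\<sigma> x = \<sigma> y"
          then have "\<tau> x - m = \<tau> y - m" by (simp add: \<sigma>_def)
          moreover have "m < \<tau> x" "m < \<tau> y" using cut[of x] cut[of y] xy by auto
          ultimately have "\<tau> x = \<tau> y" by simp
          then show "x = y" using perms_inj[OF \<tau>] by simp
        qed
        show "1 \<le> \<sigma> x \<and> \<sigma> x \<le> i" if "1 \<le> x" "x \<le> i" for x
          using cut[of x] perms_range[OF \<tau>, of x] that by (auto simp: \<sigma>_def)
      qed (auto simp: \<sigma>_def)
      moreover have "\<rho> \<in> perms m"
      proof (rule permsI)
        show "inj_on \<rho> {1..m}"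
          using perms_inj[OF \<tau>] by (auto simp: inj_on_def \<rho>_def)
        show "1 \<le> \<rho> x \<and> \<rho> x \<le> m" if "1 \<le> x" "x \<le> m" for x
          using cut[of "i + x"] perms_range[OF \<tau>, of "i + x"] that by (auto simp: \<rho>_def)
      qed (auto simp: \<rho>_def)
      moreover have "\<tau> = skew_sum i m \<sigma> \<rho>"
      proof
        fix l
        consider "l = 0 \<or> i + m < l" | "1 \<le> l" "l \<le> i" | "i < l" "l \<le> i + m" by linarith
        then show "\<tau> l = skew_sum i m \<sigma> \<rho> l"
        proof cases
          case 1
          moreover have "\<tau> l = l"
            by (rule permutes_not_in[of \<tau> "{1..i + m}"]) (use 1 \<tau> in auto)
          ultimately show ?thesis by (simp add: skew_sum_def)
        next
          case 2
          then show ?thesis using cut[of l] by (simp add: skew_sum_def \<sigma>_def)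
        next
          case 3
          then have "1 \<le> l - i" "l - i \<le> m" "i + (l - i) = l" by linarith+
          then have "\<rho> (l - i) = \<tau> l" by (simp only: \<rho>_def) simp
          then show ?thesis using 3 by (simp add: skew_sum_def)
        qed
      qed
      ultimately show "\<tau> \<in> ?f ` (perms i \<times> perms m)" by (auto intro!: image_eqI[of _ _ "(\<sigma>, \<rho>)"])
    qed
  qed
  ultimately show ?thesis by (simp add: bij_betw_def)
qed

section \<open>Generating polynomials of additive statistics\<close>

definition skew_additive :: "(nat \<Rightarrow> (nat \<Rightarrow> nat) \<Rightarrow> nat) \<Rightarrow> bool" where
  "skew_additive st \<longleftrightarrow> (\<forall>i m \<sigma> \<rho>. \<sigma> \<in> perms i \<longrightarrow> \<rho> \<in> perms m \<longrightarrow>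
     st (i + m) (skew_sum i m \<sigma> \<rho>) = st i \<sigma> + st m \<rho>)"

text \<open>
  The polynomial variable, written \<open>monom 1 1\<close> below, marks the value of the statistic: coefficient
  \<open>k\<close> counts the permutations on which the statistic takes the value \<open>k\<close>.
\<close>

definition stat_poly :: "(nat \<Rightarrow> (nat \<Rightarrow> nat) \<Rightarrow> nat) \<Rightarrow> nat \<Rightarrow> int poly" where
  "stat_poly st n = (\<Sum>\<sigma>\<in>perms n. monom 1 (st n \<sigma>))"

definition comp_poly :: "(nat \<Rightarrow> (nat \<Rightarrow> nat) \<Rightarrow> nat) \<Rightarrow> nat \<Rightarrow> nat \<Rightarrow> int poly" where
  "comp_poly st n h = (\<Sum>\<sigma> | \<sigma> \<in> perms n \<and> components n \<sigma> = h. monom 1 (st n \<sigma>))"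

lemma skew_additiveD:
  "skew_additive st \<Longrightarrow> \<sigma> \<in> perms i \<Longrightarrow> \<rho> \<in> perms m \<Longrightarrow>
    st (i + m) (skew_sum i m \<sigma> \<rho>) = st i \<sigma> + st m \<rho>"
  unfolding skew_additive_def by blast

lemma skew_additive_empty:
  assumes "skew_additive st"
  shows "st 0 id = 0"
proof -
  have "skew_sum 0 0 id id = id"
    by (auto simp: skew_sum_def fun_eq_iff)
  moreover have "st (0 + 0) (skew_sum 0 0 id id) = st 0 id + st 0 id"
    by (rule skew_additiveD[OF assms]) (auto simp: permutes_id)
  ultimately show ?thesis by simp
qed

lemma skew_cut_indecomposable:
  assumes "components n \<sigma> = 1" "skew_cut n \<sigma> c"
  shows "c = 0 \<or> c = n"
proof (rule ccontr)
  assume "\<not> ?thesis"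
  then have "{0, c} \<subseteq> {c. c < n \<and> skew_cut n \<sigma> c}" "c \<noteq> 0"
    using assms(2) skew_cut_le[OF assms(2)] by auto
  then have "card {0, c} \<le> components n \<sigma>"
    unfolding components_def by (intro card_mono) auto
  then show False using assms(1) \<open>c \<noteq> 0\<close> by simp
qed

text \<open>
  The first component ends at the least positive skew cut, so cutting there is the only way to
  write the permutation as a one-component permutation followed by a rest.
\<close>

lemma first_component_bij:
  "bij_betw (\<lambda>(i, \<sigma>, \<rho>). skew_sum i (n - i) \<sigma> \<rho>)
    (SIGMA i:{1..n}. {\<sigma> \<in> perms i. components i \<sigma> = 1} \<times>
                     {\<rho> \<in> perms (n - i). components (n - i) \<rho> = h})
    {\<tau> \<in> perms n. components n \<tau> = Suc h}"
  (is "bij_betw ?f ?D ?T")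
proof -
  have comp: "components n (skew_sum i (n - i) \<sigma> \<rho>) = components i \<sigma> + components (n - i) \<rho>"
    and perm: "skew_sum i (n - i) \<sigma> \<rho> \<in> perms n"
    and cut: "skew_cut n (skew_sum i (n - i) \<sigma> \<rho>) c \<longleftrightarrow>
      (c \<le> i \<and> skew_cut i \<sigma> c) \<or> (i \<le> c \<and> skew_cut (n - i) \<rho> (c - i))"
    if "i \<le> n" "\<sigma> \<in> perms i" "\<rho> \<in> perms (n - i)" for i \<sigma> \<rho> c
    using components_skew_sum[OF that(2,3)] skew_sum_perms[OF that(2,3)]
      skew_cut_skew_sum[OF that(2,3), of c] that(1) by (simp_all only: le_add_diff_inverse)
  \<comment> \<open>the end of one first component is a cut, hence not inside any other first component\<close>
  have le: "i \<le> j"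
    if "(i, \<sigma>, \<rho>) \<in> ?D" "(j, \<sigma>', \<rho>') \<in> ?D"
      and eq: "skew_sum i (n - i) \<sigma> \<rho> = skew_sum j (n - j) \<sigma>' \<rho>'" for i j \<sigma> \<sigma>' \<rho> \<rho>'
  proof (rule ccontr)
    assume "\<not> i \<le> j"
    have "skew_cut n (skew_sum j (n - j) \<sigma>' \<rho>') j"
      using that cut[of j \<sigma>' \<rho>' j] by simp
    then have "skew_cut i \<sigma> j"
      using that cut[of i \<sigma> \<rho> j] \<open>\<not> i \<le> j\<close> by simp
    then have "j = 0 \<or> j = i"
      using that(1) by (intro skew_cut_indecomposable) auto
    then show False using that(2) \<open>\<not> i \<le> j\<close> by auto
  qed
  have "inj_on ?f ?D"
  proof (rule inj_onI)
    fix s t assume s: "s \<in> ?D" and t: "t \<in> ?D" and eq: "?f s = ?f t"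
    obtain i \<sigma> \<rho> j \<sigma>' \<rho>' where st: "s = (i, \<sigma>, \<rho>)" "t = (j, \<sigma>', \<rho>')"
      by (cases s, cases t) auto
    have "i = j"
      using le[of i \<sigma> \<rho> j \<sigma>' \<rho>'] le[of j \<sigma>' \<rho>' i \<sigma> \<rho>] s t eq by (simp add: st)
    moreover have "(\<sigma>, \<rho>) = (\<sigma>', \<rho>')"
    proof (rule inj_onD[OF bij_betw_imp_inj_on[OF skew_sum_bij[of i "n - i"]]])
      show "(case (\<sigma>, \<rho>) of (\<sigma>, \<rho>) \<Rightarrow> skew_sum i (n - i) \<sigma> \<rho>) =
        (case (\<sigma>', \<rho>') of (\<sigma>, \<rho>) \<Rightarrow> skew_sum i (n - i) \<sigma> \<rho>)"
        using eq \<open>i = j\<close> by (simp add: st)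
    qed (use s t \<open>i = j\<close> in \<open>simp_all add: st\<close>)
    ultimately show "s = t" by (simp add: st)
  qed
  moreover have "?f ` ?D = ?T"
  proof
    show "?f ` ?D \<subseteq> ?T"
      using comp perm by fastforce
    show "?T \<subseteq> ?f ` ?D"
    proof
      fix \<tau> assume t: "\<tau> \<in> ?T"
      then have "n \<noteq> 0" by (auto intro: ccontr)
      define i where "i = (LEAST c. 1 \<le> c \<and> skew_cut n \<tau> c)"
      have i: "1 \<le> i \<and> skew_cut n \<tau> i"
        unfolding i_def by (rule LeastI[of _ n]) (use \<open>n \<noteq> 0\<close> in auto)
      have least: "c = 0" if "skew_cut n \<tau> c" "c < i" for c
        using not_less_Least[of c "\<lambda>c. 1 \<le> c \<and> skew_cut n \<tau> c"] that
        unfolding i_def by auto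
      have "i \<le> n" using i skew_cut_le by blast
      have "\<tau> \<in> {\<tau> \<in> perms (i + (n - i)). skew_cut (i + (n - i)) \<tau> i}"
        using i t \<open>i \<le> n\<close> by simp
      then have "\<tau> \<in> (\<lambda>(\<sigma>, \<rho>). skew_sum i (n - i) \<sigma> \<rho>) ` (perms i \<times> perms (n - i))"
        using bij_betw_imp_surj_on[OF skew_sum_bij[of i "n - i"]] by blast
      then obtain \<sigma> \<rho> where sr: "\<sigma> \<in> perms i" "\<rho> \<in> perms (n - i)" "\<tau> = skew_sum i (n - i) \<sigma> \<rho>"
        by auto
      have "{c. c < i \<and> skew_cut i \<sigma> c} = {0}"
        using least cut[OF \<open>i \<le> n\<close> sr(1,2)] sr(3) i by auto
      then have "components i \<sigma> = 1" by (simp add: components_def)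
      then have "(i, \<sigma>, \<rho>) \<in> ?D"
        using sr t comp[OF \<open>i \<le> n\<close> sr(1,2)] i \<open>i \<le> n\<close> by simp
      then show "\<tau> \<in> ?f ` ?D" using sr(3) by (auto intro!: image_eqI[of _ _ "(i, \<sigma>, \<rho>)"])
    qed
  qed
  ultimately show ?thesis by (simp add: bij_betw_def)
qed

lemma comp_poly_Suc:
  assumes add: "skew_additive st"
  shows "comp_poly st n (Suc h) = (\<Sum>i = 1..n. comp_poly st i 1 * comp_poly st (n - i) h)"
proof -
  let ?A = "\<lambda>i. {\<sigma> \<in> perms i. components i \<sigma> = 1}"
    and ?B = "\<lambda>i. {\<rho> \<in> perms (n - i). components (n - i) \<rho> = h}"
  have "comp_poly st n (Suc h) =
    (\<Sum>(i, \<sigma>, \<rho>)\<in>(SIGMA i:{1..n}. ?A i \<times> ?B i). monom 1 (st n (skew_sum i (n - i) \<sigma> \<rho>)))"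
    unfolding comp_poly_def sum.reindex_bij_betw[OF first_component_bij, symmetric]
    by (simp add: case_prod_unfold)
  also have "\<dots> = (\<Sum>(i, \<sigma>, \<rho>)\<in>(SIGMA i:{1..n}. ?A i \<times> ?B i).
      monom 1 (st i \<sigma>) * monom 1 (st (n - i) \<rho>))"
  proof (rule sum.cong[OF refl], clarify)
    fix i \<sigma> \<rho> assume "i \<in> {1..n}" "\<sigma> permutes {1..i}" "\<rho> permutes {1..n - i}"
    then show "monom 1 (st n (skew_sum i (n - i) \<sigma> \<rho>)) =
        monom 1 (st i \<sigma>) * (monom 1 (st (n - i) \<rho>) :: int poly)"
      using skew_additiveD[OF add, of \<sigma> i \<rho> "n - i"] by (simp add: mult_monom)
  qed
  also have "\<dots> = (\<Sum>i = 1..n. \<Sum>(\<sigma>, \<rho>)\<in>?A i \<times> ?B i. monom 1 (st i \<sigma>) * monom 1 (st (n - i) \<rho>))"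
    by (subst sum.Sigma) (auto intro!: finite_cartesian_product)
  also have "\<dots> = (\<Sum>i = 1..n. comp_poly st i 1 * comp_poly st (n - i) h)"
    by (simp add: comp_poly_def sum_product sum.cartesian_product)
  finally show ?thesis .
qed

lemma comp_poly_0: "n \<ge> 1 \<Longrightarrow> comp_poly st n 0 = 0"
proof -
  assume "n \<ge> 1"
  then have "components n \<sigma> \<noteq> 0" for \<sigma>
    using components_pos[of n \<sigma>] by linarith
  then show ?thesis unfolding comp_poly_def by (intro sum.neutral) blast
qed

lemma comp_poly_empty: "comp_poly st 0 h = (if h = 0 then monom 1 (st 0 id) else 0)"
  by (simp add: comp_poly_def id_def[symmetric] cong: conj_cong)

lemma stat_poly_eq_sum_comp_poly:
  assumes "n \<le> N"
  shows "stat_poly st n = (\<Sum>h\<le>N. comp_poly st n h)"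
proof -
  have "(\<Sum>h\<in>{..N}. \<Sum>\<sigma> | \<sigma> \<in> perms n \<and> components n \<sigma> = h. monom 1 (st n \<sigma>)) = stat_poly st n"
    unfolding stat_poly_def
    by (rule sum.group) (use components_le[of n] assms in \<open>auto intro: order_trans\<close>)
  then show ?thesis by (simp add: comp_poly_def)
qed

lemma stat_poly_first_component:
  assumes add: "skew_additive st"
  shows "stat_poly st n = (if n = 0 then 1 else 0) + (\<Sum>i\<le>n. comp_poly st i 1 * stat_poly st (n - i))"
proof (cases n)
  case 0
  then show ?thesis
    by (simp add: stat_poly_def comp_poly_empty skew_additive_empty[OF add])
next
  case (Suc n')
  have "stat_poly st n = (\<Sum>h\<le>Suc n'. comp_poly st n h)"
    by (rule stat_poly_eq_sum_comp_poly) (simp add: Suc)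
  also have "\<dots> = (\<Sum>h\<le>n'. \<Sum>i = 1..n. comp_poly st i 1 * comp_poly st (n - i) h)"
    by (simp only: sum.atMost_Suc_shift comp_poly_Suc[OF add]) (simp add: comp_poly_0 Suc)
  also have "\<dots> = (\<Sum>i = 1..n. comp_poly st i 1 * (\<Sum>h\<le>n'. comp_poly st (n - i) h))"
    by (subst sum.swap) (simp add: sum_distrib_left)
  also have "\<dots> = (\<Sum>i = 1..n. comp_poly st i 1 * stat_poly st (n - i))"
    by (intro sum.cong refl arg_cong2[of _ _ _ _ "(*)"] stat_poly_eq_sum_comp_poly[symmetric])
      (auto simp: Suc)
  also have "\<dots> = (\<Sum>i\<le>n. comp_poly st i 1 * stat_poly st (n - i))"
    by (simp add: atMost_atLeast0 sum.atLeast_Suc_atMost comp_poly_empty)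
  finally show ?thesis by (simp add: Suc)
qed

text \<open>
  A product of two generating polynomials counts permutations with a marked skew cut, and a
  permutation has one more cut than it has components.
\<close>

lemma stat_poly_square:
  assumes add: "skew_additive st"
  shows "(\<Sum>i\<le>n. stat_poly st i * stat_poly st (n - i)) =
    (\<Sum>\<sigma>\<in>perms n. of_nat (components n \<sigma> + 1) * monom 1 (st n \<sigma>))"
proof -
  have "stat_poly st i * stat_poly st (n - i) =
      (\<Sum>\<tau>\<in>perms n. if skew_cut n \<tau> i then monom 1 (st n \<tau>) else 0)" if "i \<le> n" for i
  proof -
    have bij: "bij_betw (\<lambda>(\<sigma>, \<rho>). skew_sum i (n - i) \<sigma> \<rho>) (perms i \<times> perms (n - i))
        {\<tau> \<in> perms n. skew_cut n \<tau> i}"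
      using skew_sum_bij[of i "n - i"] that by simp
    have "stat_poly st i * stat_poly st (n - i) =
        (\<Sum>(\<sigma>, \<rho>)\<in>perms i \<times> perms (n - i). monom 1 (st i \<sigma>) * monom 1 (st (n - i) \<rho>))"
      by (simp add: stat_poly_def sum_product sum.cartesian_product)
    also have "\<dots> = (\<Sum>p\<in>perms i \<times> perms (n - i).
        monom 1 (st n ((\<lambda>(\<sigma>, \<rho>). skew_sum i (n - i) \<sigma> \<rho>) p)))"
    proof (rule sum.cong[OF refl], clarify)
      fix \<sigma> \<rho> assume "\<sigma> permutes {1..i}" "\<rho> permutes {1..n - i}"
      then show "monom 1 (st i \<sigma>) * monom 1 (st (n - i) \<rho>) =
          (monom 1 (st n (skew_sum i (n - i) \<sigma> \<rho>)) :: int poly)"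
        using skew_additiveD[OF add, of \<sigma> i \<rho> "n - i"] that by (simp add: mult_monom)
    qed
    also have "\<dots> = (\<Sum>\<tau> | \<tau> \<in> perms n \<and> skew_cut n \<tau> i. monom 1 (st n \<tau>))"
      by (rule sum.reindex_bij_betw[OF bij])
    also have "\<dots> = (\<Sum>\<tau>\<in>perms n. if skew_cut n \<tau> i then monom 1 (st n \<tau>) else 0)"
      by (simp only: Collect_conj_eq Collect_mem_eq sum.inter_restrict[OF finite_perms] mem_Collect_eq)
    finally show ?thesis .
  qed
  then have "(\<Sum>i\<le>n. stat_poly st i * stat_poly st (n - i)) =
      (\<Sum>i\<le>n. \<Sum>\<tau>\<in>perms n. if skew_cut n \<tau> i then monom 1 (st n \<tau>) else 0)"
    by (intro sum.cong) auto
  also have "\<dots> = (\<Sum>\<tau>\<in>perms n. \<Sum>i\<le>n. if skew_cut n \<tau> i then monom 1 (st n \<tau>) else 0)"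
    by (rule sum.swap)
  also have "\<dots> = (\<Sum>\<tau>\<in>perms n. of_nat (components n \<tau> + 1) * monom 1 (st n \<tau>))"
  proof (rule sum.cong[OF refl])
    fix \<tau>
    have "{i. i \<le> n \<and> skew_cut n \<tau> i} = {c. skew_cut n \<tau> c}"
      by (auto dest: skew_cut_le)
    then have "card ({..n} \<inter> {i. skew_cut n \<tau> i}) = components n \<tau> + 1"
      using card_skew_cuts[of n \<tau>] by (simp add: Collect_conj_eq[symmetric] atMost_def)
    then show "(\<Sum>i\<le>n. if skew_cut n \<tau> i then monom 1 (st n \<tau>) else 0) =
        of_nat (components n \<tau> + 1) * (monom 1 (st n \<tau>) :: int poly)"
      by (simp add: sum.If_cases)
  qed
  finally show ?thesis .
qed

section \<open>Transferring the recurrence along a change of one-component weights\<close>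

definition component_recurrence :: "(nat \<Rightarrow> (nat \<Rightarrow> nat) \<Rightarrow> nat) \<Rightarrow> bool" where
  "component_recurrence st \<longleftrightarrow> (\<forall>n. stat_poly st (Suc n) = of_nat (Suc n) * stat_poly st n +
     (monom 1 1 - 1) * (\<Sum>\<sigma>\<in>perms n. of_nat (components n \<sigma>) * monom 1 (st n \<sigma>)))"

text \<open>
  With \<open>u = 1 / F\<close> and \<open>w = 1 / G\<close>, both equations become quadratic in \<open>u\<close> and \<open>w\<close> and linear
  in the derivatives, and the substitution \<open>w = u - (q - 1) X\<close> carries one into the other.
\<close>

lemma riccati_transfer:
  fixes F G I :: "'a :: comm_ring_1 fps" and q :: 'a
  assumes F: "F * (1 - I) = 1"
    and G: "G * (1 - I - fps_const (q - 1) * fps_X) = 1"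
    and G_rec: "G = 1 + fps_X^2 * fps_deriv G + fps_const q * fps_X * G"
  shows "F = 1 + fps_X * F + fps_X^2 * fps_deriv F + fps_const (q - 1) * fps_X * (F^2 - F)"
proof -
  define c where "c = fps_const (q - 1)"
  define u where "u = 1 - I"
  define w where "w = u - c * fps_X"
  have q: "fps_const q = 1 + c"
    by (simp add: c_def fps_const_sub[symmetric] del: fps_const_sub)
  have inv: "fps_deriv H = - (H^2 * fps_deriv v)" if "H * v = 1" for H v :: "'a fps"
  proof -
    have "0 = H * fps_deriv (H * v)" using that by simp
    also have "\<dots> = (H * v) * fps_deriv H + H^2 * fps_deriv v"
      by (simp add: algebra_simps power2_eq_square)
    finally show ?thesis using that by (simp add: eq_neg_iff_add_eq_0)
  qed
  have Fu: "F * u = 1" using F by (simp add: u_def)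
  have Gw: "G * w = 1" using G by (simp add: w_def u_def c_def)
  have dw: "fps_deriv w = fps_deriv u - c"
    by (simp add: w_def c_def)
  have w: "w = w^2 - fps_X^2 * (fps_deriv u - c) + (1 + c) * fps_X * w"
  proof -
    have "w = w^2 * G" using Gw by (simp add: power2_eq_square mult.assoc mult.commute[of w G])
    also have "\<dots> = w^2 * (1 + fps_X^2 * fps_deriv G + fps_const q * fps_X * G)"
      by (simp only: G_rec[symmetric])
    also have "\<dots> = w^2 - fps_X^2 * (G * w)^2 * (fps_deriv u - c) + (1 + c) * fps_X * w * (G * w)"
      unfolding inv[OF Gw] dw q by (simp add: algebra_simps power2_eq_square)
    finally show ?thesis by (simp add: Gw)
  qed
  have u: "u = u^2 - fps_X^2 * fps_deriv u + fps_X * u + c * fps_X * (1 - u)"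
  proof -
    have "u^2 - fps_X^2 * fps_deriv u + fps_X * u + c * fps_X * (1 - u) =
        (w^2 - fps_X^2 * (fps_deriv u - c) + (1 + c) * fps_X * w) + c * fps_X"
      by (simp add: w_def algebra_simps power2_eq_square)
    also have "\<dots> = u" by (simp only: w[symmetric]) (simp add: w_def)
    finally show ?thesis by simp
  qed
  have "F = F^2 * u" using Fu by (simp add: power2_eq_square mult.assoc)
  also have "\<dots> = F^2 * (u^2 - fps_X^2 * fps_deriv u + fps_X * u + c * fps_X * (1 - u))"
    by (simp only: u[symmetric])
  also have "\<dots> = (F * u)^2 + fps_X^2 * (- (F^2 * fps_deriv u)) + fps_X * F * (F * u)
      + c * fps_X * (F^2 - F * (F * u))"
    by (simp add: algebra_simps power2_eq_square)
  finally show ?thesis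
    by (simp only: Fu inv[OF Fu] c_def power_one mult_1_right add_ac)
qed

text \<open>
  The series identity \<open>F = 1 / (1 - I)\<close>: a permutation is a sequence of one-component permutations.
\<close>

lemma stat_fps_inverse:
  assumes "skew_additive st"
  shows "Abs_fps (stat_poly st) * (1 - Abs_fps (\<lambda>n. comp_poly st n 1)) = 1"
proof -
  have "Abs_fps (stat_poly st) = 1 + Abs_fps (\<lambda>n. comp_poly st n 1) * Abs_fps (stat_poly st)"
  proof (rule fps_ext)
    fix n
    show "fps_nth (Abs_fps (stat_poly st)) n = fps_nth (1 + Abs_fps (\<lambda>n. comp_poly st n 1) * Abs_fps (stat_poly st)) n"
      using stat_poly_first_component[OF assms, of n] by (simp add: fps_mult_nth atMost_atLeast0)
  qed
  then show ?thesis by (simp add: algebra_simps)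
qed

text \<open>
  For \<open>rec\<close>, each permutation of size \<open>n\<close> has \<open>n + 1\<close> extensions, one of which increases
  \<open>st'\<close>. Additive statistics are determined by their one-component weights, so a change of a single
  one of these, from \<open>1\<close> to \<open>q\<close> in size one, is enough to transfer the recurrence.
\<close>

lemma component_recurrence_transfer:
  assumes add: "skew_additive st" "skew_additive st'"
    and rec: "\<And>n. stat_poly st' (Suc n) = (of_nat n + monom 1 1) * stat_poly st' n"
    and ind: "\<And>n. comp_poly st' n 1 = comp_poly st n 1 + (if n = 1 then monom 1 1 - 1 else 0)"
  shows "component_recurrence st"
  unfolding component_recurrence_def
proof
  fix n
  let ?F = "Abs_fps (stat_poly st)" and ?G = "Abs_fps (stat_poly st')"
  let ?q = "monom 1 1 :: int poly"
  have "Abs_fps (\<lambda>n. comp_poly st' n 1) =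
      Abs_fps (\<lambda>n. comp_poly st n 1) + fps_const (?q - 1) * fps_X"
  proof (rule fps_ext)
    fix k
    show "fps_nth (Abs_fps (\<lambda>n. comp_poly st' n 1)) k =
        fps_nth (Abs_fps (\<lambda>n. comp_poly st n 1) + fps_const (?q - 1) * fps_X) k"
      using ind[of k] by (simp add: fps_X_def)
  qed
  then have G: "?G * (1 - Abs_fps (\<lambda>n. comp_poly st n 1) - fps_const (?q - 1) * fps_X) = 1"
    using stat_fps_inverse[OF add(2)] by (simp add: algebra_simps)
  have G_rec: "?G = 1 + fps_X^2 * fps_deriv ?G + fps_const ?q * fps_X * ?G"
  proof (rule fps_ext)
    fix k
    consider "k = 0" | "k = 1" | m where "k = Suc (Suc m)"
      by (metis One_nat_def not0_implies_Suc)
    then show "fps_nth ?G k = fps_nth (1 + fps_X^2 * fps_deriv ?G + fps_const ?q * fps_X * ?G) k"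
    proof cases
      case 1
      then show ?thesis
        by (simp add: stat_poly_def skew_additive_empty[OF add(2)] mult.assoc)
    next
      case 2
      then show ?thesis
        using rec[of 0] by (simp add: mult.assoc fps_X_power_mult_nth)
    next
      case 3
      then show ?thesis
        using rec[of "Suc m"]
        by (simp add: mult.assoc fps_X_power_mult_nth numeral_2_eq_2 algebra_simps)
    qed
  qed
  have eq: "?F = 1 + fps_X * ?F + fps_X^2 * fps_deriv ?F + fps_const (?q - 1) * fps_X * (?F^2 - ?F)"
    by (rule riccati_transfer[OF stat_fps_inverse[OF add(1)] G G_rec])
  have sq: "fps_nth (?F^2) n = (\<Sum>\<sigma>\<in>perms n. of_nat (components n \<sigma> + 1) * monom 1 (st n \<sigma>))"
    using stat_poly_square[OF add(1), of n]
    by (simp add: power2_eq_square fps_mult_nth atMost_atLeast0)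
  have "fps_nth (?F^2 - ?F) n = (\<Sum>\<sigma>\<in>perms n. of_nat (components n \<sigma>) * monom 1 (st n \<sigma>))"
    by (simp only: fps_sub_nth sq) (simp add: stat_poly_def ring_distribs sum.distrib)
  moreover have "fps_nth (fps_X^2 * fps_deriv ?F) (Suc n) = of_nat n * stat_poly st n"
    by (cases n) (simp_all add: power2_eq_square mult.assoc)
  moreover have "fps_nth ?F (Suc n) = fps_nth ?F n + fps_nth (fps_X^2 * fps_deriv ?F) (Suc n)
      + (?q - 1) * fps_nth (?F^2 - ?F) n"
    by (subst eq) (simp add: mult.assoc)
  ultimately show "stat_poly st (Suc n) = of_nat (Suc n) * stat_poly st n +
      (?q - 1) * (\<Sum>\<sigma>\<in>perms n. of_nat (components n \<sigma>) * monom 1 (st n \<sigma>))"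
    by (simp add: algebra_simps)
qed

section \<open>From the polynomial recurrence to the numbers of permutations\<close>

text \<open>
  The whole list of properties is bundled so that it can be moved along symmetries: it depends on
  \<open>R\<close> only through \<open>s_occ R\<close> and \<open>s_adm R\<close>.
\<close>

definition satisfies_recurrences :: "(nat \<times> nat) set \<Rightarrow> bool" where
  "satisfies_recurrences R \<longleftrightarrow>
     (\<forall>n. s_occ R n 0 = 1) \<and>
     (\<forall>k\<ge>1. s_occ R 0 k = 0) \<and>
     (\<forall>n>0. \<forall>k\<ge>0.
        int (s_occ R n k) =
          int n * int (s_occ R (n - 1) k)
          - (\<Sum>h = 1..int n - 1. h * int (s_adm R (n - 1) k h))
          + (\<Sum>h = 1..int n - 1. h * int (s_adm R (n - 1) (k - 1) h))) \<and>
     (\<forall>n\<ge>1. \<forall>k\<ge>0.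
        int (s_adm R n k 1) =
          int (s_occ R n k) - (\<Sum>h = 2..int n. int (s_adm R n k h))) \<and>
     (\<forall>n\<ge>1. \<forall>k\<ge>0. \<forall>h\<ge>2.
        s_adm R n k h =
          (\<Sum>i = 1..n - 1. \<Sum>a = 0..k. s_adm R i a 1 * s_adm R (n - i) (k - a) (h - 1))) \<and>
     s_adm R 0 0 0 = 1 \<and>
     (\<forall>k h. (k, h) \<noteq> (0, 0) \<longrightarrow> s_adm R 0 k h = 0) \<and>
     (\<forall>n\<ge>1. \<forall>k h. k \<notin> {0..int n - 1} \<or> h \<notin> {1..int n} \<longrightarrow> s_adm R n k h = 0)"

lemma s_adm_components:
  "s_adm R n k h = card {\<sigma> \<in> perms n. int (card (mesh12_occurrences R n \<sigma>)) = k \<and>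
     int (components n \<sigma>) = h}"
proof -
  have "{\<sigma>. \<sigma> permutes {1..n} \<and> int (card (mesh12_occurrences R n \<sigma>)) = k \<and>
        int (card {i. admissible n \<sigma> i}) = h} =
      {\<sigma> \<in> perms n. int (card (mesh12_occurrences R n \<sigma>)) = k \<and> int (components n \<sigma>) = h}"
    using card_admissible by auto
  then show ?thesis by (simp only: s_adm_def)
qed

lemma s_adm_le_s_occ: "s_adm R n k h \<le> s_occ R n k"
  unfolding s_adm_components s_occ_def by (rule card_mono) auto

lemma s_adm_eq_0: "n \<ge> 1 \<Longrightarrow> h \<notin> {1..int n} \<Longrightarrow> s_adm R n k h = 0"
  using components_pos[of n] components_le[of n] unfolding s_adm_components
  by (fastforce simp: card_eq_0_iff)

lemma s_occ_negative: "k < 0 \<Longrightarrow> s_occ R n k = 0"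
  by (auto simp: s_occ_def card_eq_0_iff)

lemma mesh12_occurrences_0: "mesh12_occurrences R 0 \<sigma> = {}"
  by (auto simp: mesh12_occurrences_def)

lemma s_occ_0: "s_occ R 0 k = (if k = 0 then 1 else 0)"
  by (auto simp: s_occ_def mesh12_occurrences_0)

lemma s_adm_0: "s_adm R 0 k h = (if (k, h) = (0, 0) then 1 else 0)"
  by (auto simp: s_adm_components mesh12_occurrences_0)

lemma s_occ_eq_sum_s_adm:
  assumes "n \<ge> 1"
  shows "s_occ R n k = (\<Sum>h = 1..int n. s_adm R n k h)"
proof -
  let ?P = "{\<sigma> \<in> perms n. int (card (mesh12_occurrences R n \<sigma>)) = k}"
  have "(\<Sum>h\<in>{1..int n}. \<Sum>\<sigma> | \<sigma> \<in> ?P \<and> int (components n \<sigma>) = h. 1) = (\<Sum>\<sigma>\<in>?P. (1::nat))"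
    using components_pos[OF assms] components_le[of n]
    by (intro sum.group) (auto simp: le_diff_eq Suc_le_eq)
  then show ?thesis
    unfolding s_adm_components s_occ_def by (simp add: conj_assoc)
qed

text \<open>
  The decreasing permutation has no increasing pair, hence no occurrence of any pattern, and \<open>n\<close>
  components. Once it is known that only one permutation avoids the pattern, it must be this one.
\<close>

definition decreasing_perm :: "nat \<Rightarrow> nat \<Rightarrow> nat" where
  "decreasing_perm n l = (if 1 \<le> l \<and> l \<le> n then n + 1 - l else l)"

lemma decreasing_perm_perms: "decreasing_perm n \<in> perms n"
  by (rule permsI) (auto simp: decreasing_perm_def inj_on_def)

lemma mesh12_occurrences_decreasing: "mesh12_occurrences R n (decreasing_perm n) = {}"
  by (auto simp: mesh12_occurrences_def decreasing_perm_def)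

lemma components_decreasing: "components n (decreasing_perm n) = n"
proof -
  have "{c. c < n \<and> skew_cut n (decreasing_perm n) c} = {..<n}"
    by (auto simp: skew_cut_def decreasing_perm_def)
  then show ?thesis by (simp add: components_def)
qed

lemma s_adm_avoiders:
  assumes "s_occ R n 0 = 1"
  shows "s_adm R n 0 h = (if h = int n then 1 else 0)"
proof -
  obtain \<delta> where "{\<sigma>. \<sigma> permutes {1..n} \<and> int (card (mesh12_occurrences R n \<sigma>)) = 0} = {\<delta>}"
    using assms unfolding s_occ_def by (auto simp: card_1_singleton_iff)
  moreover have "decreasing_perm n \<in>
      {\<sigma>. \<sigma> permutes {1..n} \<and> int (card (mesh12_occurrences R n \<sigma>)) = 0}"
    using decreasing_perm_perms[of n] mesh12_occurrences_decreasing[of R n] by simp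
  ultimately have eq: "{\<sigma> \<in> perms n. int (card (mesh12_occurrences R n \<sigma>)) = 0} = {decreasing_perm n}"
    by auto
  have "{\<sigma> \<in> perms n. int (card (mesh12_occurrences R n \<sigma>)) = 0 \<and> int (components n \<sigma>) = h} =
      {\<sigma> \<in> {decreasing_perm n}. int (components n \<sigma>) = h}"
    unfolding eq[symmetric] by blast
  also have "\<dots> = (if h = int n then {decreasing_perm n} else {})"
    using components_decreasing[of n] by auto
  finally show ?thesis
    unfolding s_adm_components by simp
qed

lemma coeff_sum_monom:
  "finite A \<Longrightarrow> coeff (\<Sum>x\<in>A. monom (1::int) (f x)) k = int (card {x \<in> A. f x = k})"
  by (simp add: coeff_sum sum.If_cases Int_def)

lemma sum_int_atLeast1: "(\<Sum>h = 1..int n. f h) = (\<Sum>h = 1..n. f (int h))"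
proof -
  have "{1..int n} = int ` {1..n}" by (simp add: image_int_atLeastAtMost)
  then show ?thesis by (simp add: sum.reindex)
qed

lemma sum_int_atLeast0: "(\<Sum>h = 0..int n. f h) = (\<Sum>h\<le>n. f (int h))"
proof -
  have "{0..int n} = int ` {0..n}" by (simp add: image_int_atLeastAtMost)
  then show ?thesis by (simp add: sum.reindex atMost_atLeast0)
qed

text \<open>
  The two polynomial identities, read off coefficient by coefficient. That there is exactly one
  avoider and that no permutation has \<open>n\<close> or more occurrences follow from the recurrence by
  induction: the contributions of the decreasing permutation cancel all but one of the \<open>n + 1\<close>
  insertions.
\<close>

lemma satisfies_recurrences_by_statistic:
  assumes st: "\<And>n \<sigma>. \<sigma> \<in> perms n \<Longrightarrow> card (mesh12_occurrences R n \<sigma>) = st n \<sigma>"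
    and add: "skew_additive st" and rec: "component_recurrence st"
  shows "satisfies_recurrences R"
proof -
  have occ: "int (s_occ R n (int k)) = coeff (stat_poly st n) k" for n k
  proof -
    have "{\<sigma>. \<sigma> permutes {1..n} \<and> int (card (mesh12_occurrences R n \<sigma>)) = int k} =
        {\<sigma> \<in> perms n. st n \<sigma> = k}"
      using st by auto
    then show ?thesis
      unfolding s_occ_def stat_poly_def by (simp only: coeff_sum_monom[OF finite_perms])
  qed
  have adm: "int (s_adm R n (int k) (int h)) = coeff (comp_poly st n h) k" for n k h
  proof -
    have "{\<sigma> \<in> perms n. int (card (mesh12_occurrences R n \<sigma>)) = int k \<and> int (components n \<sigma>) = int h} =
        {\<sigma> \<in> {\<sigma> \<in> perms n. components n \<sigma> = h}. st n \<sigma> = k}"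
      using st by auto
    moreover have "finite {\<sigma> \<in> perms n. components n \<sigma> = h}"
      by (rule finite_subset[OF _ finite_perms]) blast
    ultimately show ?thesis
      unfolding s_adm_components comp_poly_def by (simp only: coeff_sum_monom)
  qed
  have adm_neg: "s_adm R n k h = 0" if "k < 0" for n k h
    using s_adm_le_s_occ[of R n k h] s_occ_negative[OF that, of R n] by simp
  have main: "int (s_occ R n k) = int n * int (s_occ R (n - 1) k)
          - (\<Sum>h = 1..int n - 1. h * int (s_adm R (n - 1) k h))
          + (\<Sum>h = 1..int n - 1. h * int (s_adm R (n - 1) (k - 1) h))"
    if n: "n > 0" and k: "k \<ge> 0" for n k
  proof -
    obtain m where m: "n = Suc m" using n gr0_implies_Suc by blast
    obtain k' where k': "k = int k'" using k nonneg_int_cases by blast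
    \<comment> \<open>grouped by the number of components, this gives both sums over \<open>h\<close>\<close>
    let ?W = "\<Sum>\<sigma>\<in>perms m. of_nat (components m \<sigma>) * monom 1 (st m \<sigma>) :: int poly"
    have W: "coeff ?W j = (\<Sum>h = 1..int m. h * int (s_adm R m (int j) h))" for j
    proof -
      have "?W = (\<Sum>h\<le>m. \<Sum>\<sigma> | \<sigma> \<in> perms m \<and> components m \<sigma> = h.
          of_nat (components m \<sigma>) * monom 1 (st m \<sigma>))"
        by (rule sum.group[symmetric]) (use components_le[of m] in auto)
      also have "\<dots> = (\<Sum>h\<le>m. of_nat h * comp_poly st m h)"
        by (simp add: comp_poly_def sum_distrib_left)
      finally have "coeff ?W j = (\<Sum>h\<le>m. int h * coeff (comp_poly st m h) j)"
        by (simp add: coeff_sum of_nat_poly)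
      also have "\<dots> = (\<Sum>h = 1..m. int h * int (s_adm R m (int j) (int h)))"
        by (simp add: adm atMost_atLeast0 sum.atLeast_Suc_atMost)
      finally show ?thesis by (simp only: sum_int_atLeast1)
    qed
    have "int (s_occ R n k) = coeff (of_nat (Suc m) * stat_poly st m + (monom 1 1 - 1) * ?W) k'"
      using rec unfolding component_recurrence_def by (simp only: m k' occ)
    also have "\<dots> = int (Suc m) * coeff (stat_poly st m) k' +
        ((if k' = 0 then 0 else coeff ?W (k' - 1)) - coeff ?W k')"
      by (simp only: coeff_add left_diff_distrib coeff_diff coeff_monom_mult of_nat_poly) auto
    also have "(if k' = 0 then 0 else coeff ?W (k' - 1)) =
        (\<Sum>h = 1..int m. h * int (s_adm R m (k - 1) h))"
    proof (cases k')
      case 0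
      then show ?thesis by (simp add: k' adm_neg)
    next
      case (Suc j)
      then have "k - 1 = int j" "k' - 1 = j" by (simp_all add: k')
      then show ?thesis using Suc by (simp only: W) simp
    qed
    finally show ?thesis by (simp only: W k' occ[symmetric]) (simp add: m)
  qed
  have conv: "s_adm R n k h =
        (\<Sum>i = 1..n - 1. \<Sum>a = 0..k. s_adm R i a 1 * s_adm R (n - i) (k - a) (h - 1))"
    if n: "n \<ge> 1" and k: "k \<ge> 0" and h: "h \<ge> 2" for n k h
  proof -
    obtain k' where k': "k = int k'" using k nonneg_int_cases by blast
    obtain h' where h': "h = int (Suc h')" "h' \<ge> 1"
      using h by (intro that[of "nat (h - 1)"]) auto
    obtain m where m: "n = Suc m" using n by (cases n) auto
    have "int (s_adm R n k h) = coeff (\<Sum>i = 1..n. comp_poly st i 1 * comp_poly st (n - i) h') k'"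
      by (simp only: k' h' adm comp_poly_Suc[OF add])
    also have "\<dots> = coeff (\<Sum>i = 1..n - 1. comp_poly st i 1 * comp_poly st (n - i) h') k'"
      using h'(2) by (simp add: m comp_poly_empty)
    also have "\<dots> = (\<Sum>i = 1..n - 1. \<Sum>a\<le>k'. coeff (comp_poly st i 1) a *
        coeff (comp_poly st (n - i) h') (k' - a))"
      by (simp add: coeff_sum coeff_mult)
    also have "\<dots> = (\<Sum>i = 1..n - 1. \<Sum>a\<le>k'. int (s_adm R i (int a) 1 *
        s_adm R (n - i) (k - int a) (h - 1)))"
    proof (intro sum.cong refl)
      fix i a assume "a \<in> {..k'}"
      then have "k - int a = int (k' - a)" "h - 1 = int h'" by (auto simp: k' h')
      then show "coeff (comp_poly st i 1) a * coeff (comp_poly st (n - i) h') (k' - a) =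
          int (s_adm R i (int a) 1 * s_adm R (n - i) (k - int a) (h - 1))"
        using adm[of i a 1] by (simp add: adm)
    qed
    also have "\<dots> = int (\<Sum>i = 1..n - 1. \<Sum>a = 0..k.
        s_adm R i a 1 * s_adm R (n - i) (k - a) (h - 1))"
      by (simp only: k' sum_int_atLeast0 of_nat_sum)
    finally show ?thesis by (simp only: of_nat_eq_iff)
  qed
  have one: "s_occ R n 0 = 1" for n
  proof (induction n)
    case 0
    then show ?case by (simp add: s_occ_0)
  next
    case (Suc n)
    have "int (s_occ R (Suc n) 0) = int (Suc n) - (\<Sum>h = 1..int n. h * int (if h = int n then 1 else 0))"
      using main[of "Suc n" 0] by (simp add: Suc s_adm_avoiders[OF Suc] adm_neg)
    also have "(\<Sum>h = 1..int n. h * int (if h = int n then 1 else 0)) = int n"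
      by (cases n) (simp_all add: if_distrib cong: if_cong)
    finally show ?case by simp
  qed
  have large: "s_occ R n k = 0" if "n \<ge> 1" "k \<ge> int n" for n k
    using that
  proof (induction n arbitrary: k)
    case (Suc n)
    have "s_occ R n k = 0"
      using Suc by (cases n) (auto simp: s_occ_0)
    moreover have "s_adm R n k h = 0" for h
      using s_adm_le_s_occ[of R n k h] calculation by simp
    moreover have "(\<Sum>h = 1..int n. h * int (s_adm R n (k - 1) h)) = 0"
    proof (cases "n = 0")
      case False
      then have "s_occ R n (k - 1) = 0" using Suc by simp
      then have "s_adm R n (k - 1) h = 0" for h
        using s_adm_le_s_occ[of R n "k - 1" h] by simp
      then show ?thesis by simp
    qed simp
    ultimately show ?case using main[of "Suc n" k] Suc.prems by simp
  qed simp
  have "s_adm R n k h = 0" if "n \<ge> 1" "k \<notin> {0..int n - 1} \<or> h \<notin> {1..int n}" for n k h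
    using that s_adm_eq_0[OF that(1)] adm_neg[of k n h] s_adm_le_s_occ[of R n k h] large[of n k]
    by (cases "k < 0"; cases "k \<ge> int n") auto
  moreover have "int (s_adm R n k 1) = int (s_occ R n k) - (\<Sum>h = 2..int n. int (s_adm R n k h))"
    if "n \<ge> 1" for n k
  proof -
    have "{1..int n} = insert 1 {2..int n}" using that by auto
    then show ?thesis by (simp add: s_occ_eq_sum_s_adm[OF that])
  qed
  ultimately show ?thesis
    unfolding satisfies_recurrences_def
    using one main conv by (intro conjI allI impI) (simp_all add: s_occ_0 s_adm_0)
qed

section \<open>Right-to-left maxima and unobstructed climbs\<close>

definition rl_maxima :: "nat \<Rightarrow> (nat \<Rightarrow> nat) \<Rightarrow> nat set" where
  "rl_maxima n \<sigma> = {j \<in> {1..n}. \<forall>l\<in>{1..n}. j < l \<longrightarrow> \<sigma> l < \<sigma> j}"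

text \<open>
  A right-to-left maximum with no smaller letter before it is a component of size one; these are
  left out.
\<close>

definition nontrivial_rl_maxima :: "nat \<Rightarrow> (nat \<Rightarrow> nat) \<Rightarrow> nat set" where
  "nontrivial_rl_maxima n \<sigma> = {j \<in> rl_maxima n \<sigma>. \<exists>l\<in>{1..n}. l < j \<and> \<sigma> l < \<sigma> j}"

text \<open>
  A climb leads from a position to the maximum of the letters to its right; it is obstructed by an
  earlier letter whose value lies between its two ends.
\<close>

definition unobstructed_climbs :: "nat \<Rightarrow> (nat \<Rightarrow> nat) \<Rightarrow> nat set" where
  "unobstructed_climbs n \<sigma> = {i \<in> {1..n}. \<exists>j\<in>{1..n}. i < j \<and> \<sigma> i < \<sigma> j \<and>
     (\<forall>l\<in>{1..n}. i < l \<longrightarrow> \<sigma> l \<le> \<sigma> j) \<and> (\<forall>l\<in>{1..n}. l < i \<longrightarrow> \<sigma> i < \<sigma> l \<longrightarrow> \<sigma> j \<le> \<sigma> l)}"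

lemma ball_add: "(\<forall>l\<in>{1..i + m}. Q l) \<longleftrightarrow> (\<forall>l\<in>{1..i}. Q l) \<and> (\<forall>l\<in>{1..m}. Q (i + l))" for i :: nat
proof (intro iffI conjI ballI)
  fix l assume h: "(\<forall>l\<in>{1..i}. Q l) \<and> (\<forall>l\<in>{1..m}. Q (i + l))" "l \<in> {1..i + m}"
  show "Q l"
  proof (cases "l \<le> i")
    case False
    then have "l - i \<in> {1..m}" "l = i + (l - i)" using h(2) by auto
    then show ?thesis using h(1) by metis
  qed (use h in auto)
qed auto

lemma bex_add: "(\<exists>l\<in>{1..i + m}. Q l) \<longleftrightarrow> (\<exists>l\<in>{1..i}. Q l) \<or> (\<exists>l\<in>{1..m}. Q (i + l))" for i :: nat
  using ball_add[of i m "\<lambda>l. \<not> Q l"] by blast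

text \<open>
  A statistic that counts positions is additive if membership of a position depends only on the
  summand that contains it.
\<close>

lemma skew_additive_card:
  assumes sub: "\<And>n \<sigma>. P n \<sigma> \<subseteq> {1..n}"
    and left: "\<And>i m \<sigma> \<rho> j. \<lbrakk>\<sigma> \<in> perms i; \<rho> \<in> perms m; j \<in> {1..i}\<rbrakk> \<Longrightarrow>
      j \<in> P (i + m) (skew_sum i m \<sigma> \<rho>) \<longleftrightarrow> j \<in> P i \<sigma>"
    and right: "\<And>i m \<sigma> \<rho> j. \<lbrakk>\<sigma> \<in> perms i; \<rho> \<in> perms m; j \<in> {1..m}\<rbrakk> \<Longrightarrow>
      i + j \<in> P (i + m) (skew_sum i m \<sigma> \<rho>) \<longleftrightarrow> j \<in> P m \<rho>"
  shows "skew_additive (\<lambda>n \<sigma>. card (P n \<sigma>))"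
  unfolding skew_additive_def
proof (intro allI impI)
  fix i m \<sigma> \<rho> assume h: "\<sigma> \<in> perms i" "\<rho> \<in> perms m"
  have "P (i + m) (skew_sum i m \<sigma> \<rho>) = P i \<sigma> \<union> (+) i ` P m \<rho>"
  proof (intro set_eqI)
    fix j
    consider "j \<in> {1..i}" | d where "j = i + d" "d \<in> {1..m}" | "j = 0 \<or> i + m < j"
    proof (cases "j \<in> {1..i} \<or> j = 0 \<or> i + m < j")
      case False
      then show ?thesis using that(2)[of "j - i"] by auto
    qed (use that in blast)
    then show "j \<in> P (i + m) (skew_sum i m \<sigma> \<rho>) \<longleftrightarrow> j \<in> P i \<sigma> \<union> (+) i ` P m \<rho>"
    proof cases
      case 1
      then have "j \<notin> (+) i ` P m \<rho>" using sub[of m \<rho>] by auto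
      then show ?thesis using left[OF h 1] by simp
    next
      case 2
      then have "j \<notin> P i \<sigma>" using sub[of i \<sigma>] by auto
      then show ?thesis using right[OF h 2(2)] 2(1) by auto
    next
      case 3
      then show ?thesis
        using sub[of i \<sigma>] sub[of m \<rho>] sub[of "i + m" "skew_sum i m \<sigma> \<rho>"] by fastforce
    qed
  qed
  moreover have "P i \<sigma> \<inter> (+) i ` P m \<rho> = {}"
    using sub[of i \<sigma>] sub[of m \<rho>] by fastforce
  moreover have "finite (P i \<sigma>)" "finite (P m \<rho>)"
    using sub finite_subset by blast+
  ultimately show "card (P (i + m) (skew_sum i m \<sigma> \<rho>)) = card (P i \<sigma>) + card (P m \<rho>)"
    by (simp add: card_Un_disjoint card_image)
qed

lemma skew_sum_cross:
  assumes "\<sigma> \<in> perms i" "\<rho> \<in> perms m" "l \<in> {1..i}" "r \<in> {1..m}"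
  shows "\<rho> r < m + \<sigma> l" "\<rho> r \<le> m + \<sigma> l" "\<not> m + \<sigma> l < \<rho> r"
  using perms_range[OF assms(1), of l] perms_range[OF assms(2), of r] assms(3,4) by auto

lemma skew_additive_rl_maxima: "skew_additive (\<lambda>n \<sigma>. card (rl_maxima n \<sigma>))"
  by (rule skew_additive_card)
    (auto simp: rl_maxima_def ball_add skew_sum_left skew_sum_right skew_sum_cross
      simp del: One_nat_def)

lemma skew_additive_nontrivial_rl_maxima:
  "skew_additive (\<lambda>n \<sigma>. card (nontrivial_rl_maxima n \<sigma>))"
  by (rule skew_additive_card)
    (auto simp: nontrivial_rl_maxima_def rl_maxima_def ball_add bex_add skew_sum_left
      skew_sum_right skew_sum_cross simp del: One_nat_def)

lemma skew_additive_unobstructed_climbs: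
  "skew_additive (\<lambda>n \<sigma>. card (unobstructed_climbs n \<sigma>))"
  by (rule skew_additive_card)
    (auto simp: unobstructed_climbs_def ball_add bex_add skew_sum_left
      skew_sum_right skew_sum_cross simp del: One_nat_def)

lemma atLeastAtMost_shift: "1 \<le> a \<Longrightarrow> a \<le> n + 1 \<Longrightarrow> {1..n + 1} = insert a (shift a ` {1..n})"
proof -
  assume a: "1 \<le> a" "a \<le> n + 1"
  show ?thesis
  proof (intro set_eqI)
    fix l
    show "l \<in> {1..n + 1} \<longleftrightarrow> l \<in> insert a (shift a ` {1..n})"
    proof (cases "l = a")
      case False
      then obtain x where x: "l = shift a x" using shift_surj by blast
      then have "l \<in> {1..n + 1} \<longleftrightarrow> x \<in> {1..n}"
        by (simp only: atLeastAtMost_iff shift_ge_1_iff[OF a(1)] shift_le_iff[OF a(2)])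
      then show ?thesis using x False by auto
    qed (use a in simp)
  qed
qed

lemma card_insert_one:
  assumes a: "1 \<le> a" "a \<le> n + 1"
    and sub: "P \<subseteq> {1..n + 1}" "Q \<subseteq> {1..n}"
    and old: "\<And>j. j \<in> {1..n} \<Longrightarrow> shift a j \<in> P \<longleftrightarrow> j \<in> Q"
  shows "card P = card Q + (if a \<in> P then 1 else 0)"
proof -
  have "P = shift a ` Q \<union> (if a \<in> P then {a} else {})"
  proof (intro set_eqI)
    fix l
    show "l \<in> P \<longleftrightarrow> l \<in> shift a ` Q \<union> (if a \<in> P then {a} else {})"
    proof (cases "l \<in> shift a ` {1..n}")
      case True
      then obtain j where "j \<in> {1..n}" "l = shift a j" by blast
      then show ?thesis using old[of j] by auto
    next
      case False
      then have "l \<in> P \<Longrightarrow> l = a" "l \<notin> shift a ` Q"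
        using sub unfolding atLeastAtMost_shift[OF a] by blast+
      then show ?thesis by auto
    qed
  qed
  moreover have "finite Q" using sub(2) finite_subset by blast
  moreover have "card (shift a ` Q) = card Q" "a \<notin> shift a ` Q"
    by (auto simp: card_image inj_on_def)
  ultimately show ?thesis
    using card_Un_disjoint[of "shift a ` Q" "if a \<in> P then {a} else {}"] by auto
qed

lemma card_rl_maxima_insert_one:
  assumes \<sigma>: "\<sigma> \<in> perms n" and a: "1 \<le> a" "a \<le> n + 1"
  shows "card (rl_maxima (n + 1) (insert_one a \<sigma>)) = card (rl_maxima n \<sigma>) + (if a = n + 1 then 1 else 0)"
proof -
  have pos: "\<sigma> l \<ge> 1" if "l \<in> {1..n}" for l
    using perms_range[OF \<sigma>, of l] that by auto
  have "a \<in> rl_maxima (n + 1) (insert_one a \<sigma>) \<longleftrightarrow> (\<forall>l\<in>{1..n}. \<not> a < shift a l)"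
    using a unfolding rl_maxima_def atLeastAtMost_shift[OF a]
    by (simp add: insert_one_self insert_one_shift)
  also have "\<dots> \<longleftrightarrow> (\<forall>l\<in>{1..n}. l < a)"
    by (auto simp: shift_def)
  also have "\<dots> \<longleftrightarrow> a = n + 1"
    using a by (cases n) (auto simp: Suc_le_eq le_Suc_eq)
  moreover have "card (rl_maxima (n + 1) (insert_one a \<sigma>)) = card (rl_maxima n \<sigma>) +
      (if a \<in> rl_maxima (n + 1) (insert_one a \<sigma>) then 1 else 0)"
  proof (rule card_insert_one[OF a])
    show "shift a j \<in> rl_maxima (n + 1) (insert_one a \<sigma>) \<longleftrightarrow> j \<in> rl_maxima n \<sigma>" if "j \<in> {1..n}" for j
      using a that pos[OF that] unfolding rl_maxima_def atLeastAtMost_shift[OF a]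
      by (auto simp: insert_one_self insert_one_shift)
  qed (auto simp: rl_maxima_def)
  ultimately show ?thesis by simp
qed

text \<open>
  An old position is not affected, because the new letter is smaller than everything. The new
  position qualifies if every letter before it is at least the maximum of the letters after it,
  which is the condition for a skew cut, and there is some letter after it.
\<close>

lemma card_unobstructed_climbs_insert_one:
  assumes \<sigma>: "\<sigma> \<in> perms n" and a: "1 \<le> a" "a \<le> n + 1"
  shows "card (unobstructed_climbs (n + 1) (insert_one a \<sigma>)) =
    card (unobstructed_climbs n \<sigma>) + (if admissible n \<sigma> a then 1 else 0)"
proof -
  let ?\<tau> = "insert_one a \<sigma>"
  have pos: "\<sigma> l \<ge> 1" if "l \<in> {1..n}" for l
    using perms_range[OF \<sigma>, of l] that by auto
  have "a \<in> unobstructed_climbs (n + 1) ?\<tau> \<longleftrightarrow>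
      (\<exists>j\<in>{1..n}. a \<le> j \<and> (\<forall>l\<in>{1..n}. a \<le> l \<longrightarrow> \<sigma> l \<le> \<sigma> j) \<and> (\<forall>l\<in>{1..n}. l < a \<longrightarrow> \<sigma> j \<le> \<sigma> l))"
  proof -
    have sh: "shift a x < a \<longleftrightarrow> x < a" "a < shift a x \<longleftrightarrow> a \<le> x" for x
      by (auto simp: shift_def)
    show ?thesis
      using a pos unfolding unobstructed_climbs_def atLeastAtMost_shift[OF a]
      by (simp add: insert_one_self insert_one_shift sh Suc_le_eq less_Suc_eq_le)
  qed
  also have "\<dots> \<longleftrightarrow> admissible n \<sigma> a"
  proof
    assume "\<exists>j\<in>{1..n}. a \<le> j \<and> (\<forall>l\<in>{1..n}. a \<le> l \<longrightarrow> \<sigma> l \<le> \<sigma> j) \<and> (\<forall>l\<in>{1..n}. l < a \<longrightarrow> \<sigma> j \<le> \<sigma> l)"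
    then obtain j where j: "j \<in> {1..n}" "a \<le> j" "\<And>l. l \<in> {1..n} \<Longrightarrow> a \<le> l \<Longrightarrow> \<sigma> l \<le> \<sigma> j"
      "\<And>l. l \<in> {1..n} \<Longrightarrow> l < a \<Longrightarrow> \<sigma> j \<le> \<sigma> l"
      by blast
    have "\<sigma> y < \<sigma> x" if "1 \<le> x" "x \<le> a - 1" "a - 1 < y" "y \<le> n" for x y
    proof -
      have "x \<in> {1..n}" "x < a" "y \<in> {1..n}" "a \<le> y" "x \<noteq> y" using that a by auto
      then show ?thesis
        using j(3)[of y] j(4)[of x] perms_inj[OF \<sigma>, of x y] by fastforce
    qed
    then show "admissible n \<sigma> a"
      using j a by (auto simp: admissible_iff_skew_cut[OF \<sigma>] skew_cut_def)
  next
    assume adm: "admissible n \<sigma> a"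
    then have an: "a \<le> n" and cut: "skew_cut n \<sigma> (a - 1)"
      by (auto simp: admissible_iff_skew_cut[OF \<sigma>])
    obtain j where j: "j \<in> {a..n}" "\<And>l. l \<in> {a..n} \<Longrightarrow> \<sigma> l \<le> \<sigma> j"
    proof -
      have "Max (\<sigma> ` {a..n}) \<in> \<sigma> ` {a..n}" using an by (intro Max_in) auto
      then obtain j where "j \<in> {a..n}" "\<sigma> j = Max (\<sigma> ` {a..n})" by auto
      then show ?thesis using that[of j] by simp
    qed
    have "\<sigma> j \<le> \<sigma> l" if "l \<in> {1..n}" "l < a" for l
    proof -
      have "1 \<le> l" "l \<le> a - 1" "a - 1 < j" "j \<le> n" using that j a by auto
      then show ?thesis using cut by (auto simp: skew_cut_def intro: less_imp_le)
    qed
    then show "\<exists>j\<in>{1..n}. a \<le> j \<and> (\<forall>l\<in>{1..n}. a \<le> l \<longrightarrow> \<sigma> l \<le> \<sigma> j) \<and> (\<forall>l\<in>{1..n}. l < a \<longrightarrow> \<sigma> j \<le> \<sigma> l)"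
      using j a by (intro bexI[of _ j]) auto
  qed
  moreover have "card (unobstructed_climbs (n + 1) ?\<tau>) = card (unobstructed_climbs n \<sigma>) +
      (if a \<in> unobstructed_climbs (n + 1) ?\<tau> then 1 else 0)"
  proof (rule card_insert_one[OF a])
    show "shift a j \<in> unobstructed_climbs (n + 1) ?\<tau> \<longleftrightarrow> j \<in> unobstructed_climbs n \<sigma>"
      if "j \<in> {1..n}" for j
      using a that pos[OF that] unfolding unobstructed_climbs_def atLeastAtMost_shift[OF a]
      by (auto simp: insert_one_self insert_one_shift)
  qed (auto simp: unobstructed_climbs_def)
  ultimately show ?thesis by simp
qed

lemma stat_poly_insert_one:
  assumes "\<And>\<sigma> a. \<lbrakk>\<sigma> \<in> perms n; 1 \<le> a; a \<le> n + 1\<rbrakk> \<Longrightarrow>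
      st (n + 1) (insert_one a \<sigma>) = st n \<sigma> + (if Q \<sigma> a then 1 else 0)"
  shows "stat_poly st (Suc n) = (\<Sum>\<sigma>\<in>perms n.
    (of_nat (n + 1) + of_nat (card {a \<in> {1..n + 1}. Q \<sigma> a}) * (monom 1 1 - 1)) * monom 1 (st n \<sigma>))"
proof -
  have "stat_poly st (Suc n) =
      (\<Sum>(a, \<sigma>)\<in>{1..n + 1} \<times> perms n. monom 1 (st (n + 1) (insert_one a \<sigma>)))"
    unfolding stat_poly_def Suc_eq_plus1 sum.reindex_bij_betw[OF insert_one_bij, symmetric]
    by (simp add: case_prod_unfold)
  also have "\<dots> = (\<Sum>\<sigma>\<in>perms n. \<Sum>a\<in>{1..n + 1}. monom 1 (st (n + 1) (insert_one a \<sigma>)))"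
    unfolding sum.cartesian_product[symmetric] by (rule sum.swap)
  also have "\<dots> = (\<Sum>\<sigma>\<in>perms n.
    (of_nat (n + 1) + of_nat (card {a \<in> {1..n + 1}. Q \<sigma> a}) * (monom 1 1 - 1)) * monom 1 (st n \<sigma>))"
  proof (rule sum.cong[OF refl])
    fix \<sigma> assume \<sigma>: "\<sigma> \<in> perms n"
    let ?m = "monom 1 (st n \<sigma>) :: int poly"
    have "(\<Sum>a\<in>{1..n + 1}. monom 1 (st (n + 1) (insert_one a \<sigma>))) =
        (\<Sum>a\<in>{1..n + 1}. ?m + (if Q \<sigma> a then (monom 1 1 - 1) * ?m else 0))"
    proof (rule sum.cong[OF refl])
      fix a assume "a \<in> {1..n + 1}"
      then have "st (n + 1) (insert_one a \<sigma>) = st n \<sigma> + (if Q \<sigma> a then 1 else 0)"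
        using assms[OF \<sigma>, of a] by simp
      then show "monom 1 (st (n + 1) (insert_one a \<sigma>)) =
          ?m + (if Q \<sigma> a then (monom 1 1 - 1) * ?m else 0)"
        by (simp add: mult_monom left_diff_distrib)
    qed
    also have "\<dots> = of_nat (n + 1) * ?m + (\<Sum>a\<in>{1..n + 1}. if Q \<sigma> a then (monom 1 1 - 1) * ?m else 0)"
      by (simp only: sum.distrib sum_constant card_atLeastAtMost) simp
    also have "(\<Sum>a\<in>{1..n + 1}. if Q \<sigma> a then (monom 1 1 - 1) * ?m else 0) =
        of_nat (card {a \<in> {1..n + 1}. Q \<sigma> a}) * ((monom 1 1 - 1) * ?m)"
      by (simp only: sum.inter_filter[symmetric] finite_atLeastAtMost sum_constant)
    finally show "(\<Sum>a\<in>{1..n + 1}. monom 1 (st (n + 1) (insert_one a \<sigma>))) =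
      (of_nat (n + 1) + of_nat (card {a \<in> {1..n + 1}. Q \<sigma> a}) * (monom 1 1 - 1)) * ?m"
      by (simp only: ring_distribs mult.assoc)
  qed
  finally show ?thesis .
qed

lemma component_recurrence_unobstructed_climbs:
  "component_recurrence (\<lambda>n \<sigma>. card (unobstructed_climbs n \<sigma>))"
  unfolding component_recurrence_def
proof
  fix n
  let ?st = "\<lambda>n \<sigma>. card (unobstructed_climbs n \<sigma>)"
  have "card {a \<in> {1..n + 1}. admissible n \<sigma> a} = components n \<sigma>" if "\<sigma> \<in> perms n" for \<sigma>
  proof -
    have "{a \<in> {1..n + 1}. admissible n \<sigma> a} = {a. admissible n \<sigma> a}"
      by (auto simp: admissible_def)
    then show ?thesis using card_admissible[OF that] by simp
  qed
  then have "stat_poly ?st (Suc n) = (\<Sum>\<sigma>\<in>perms n.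
      (of_nat (n + 1) + of_nat (components n \<sigma>) * (monom 1 1 - 1)) * monom 1 (?st n \<sigma>))"
    by (subst stat_poly_insert_one[where Q = "admissible n", OF card_unobstructed_climbs_insert_one])
      (auto intro!: sum.cong)
  then show "stat_poly ?st (Suc n) = of_nat (Suc n) * stat_poly ?st n +
      (monom 1 1 - 1) * (\<Sum>\<sigma>\<in>perms n. of_nat (components n \<sigma>) * monom 1 (?st n \<sigma>))"
    by (simp only: stat_poly_def ring_distribs sum.distrib sum_distrib_left mult_ac Suc_eq_plus1)
qed

lemma stat_poly_rl_maxima_Suc:
  "stat_poly (\<lambda>n \<sigma>. card (rl_maxima n \<sigma>)) (Suc n) =
    (of_nat n + monom 1 1) * stat_poly (\<lambda>n \<sigma>. card (rl_maxima n \<sigma>)) n"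
proof -
  have "{a \<in> {1..n + 1}. a = n + 1} = {n + 1}" by auto
  then have "stat_poly (\<lambda>n \<sigma>. card (rl_maxima n \<sigma>)) (Suc n) = (\<Sum>\<sigma>\<in>perms n.
      (of_nat (n + 1) + of_nat (card {n + 1}) * (monom 1 1 - 1)) * monom 1 (card (rl_maxima n \<sigma>)))"
    by (subst stat_poly_insert_one[where Q = "\<lambda>\<sigma> a. a = n + 1", OF card_rl_maxima_insert_one])
      auto
  then show ?thesis
    by (simp add: stat_poly_def sum_distrib_left)
qed

text \<open>
  A right-to-left maximum without smaller letters before it has a skew cut on either side.
\<close>

lemma nontrivial_rl_maxima_indecomposable:
  assumes "components n \<sigma> = 1" "n \<noteq> 1" and \<sigma>: "\<sigma> \<in> perms n"
  shows "nontrivial_rl_maxima n \<sigma> = rl_maxima n \<sigma>"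
proof (rule ccontr)
  assume "\<not> ?thesis"
  then obtain j where "j \<in> rl_maxima n \<sigma>" "j \<notin> nontrivial_rl_maxima n \<sigma>"
    unfolding nontrivial_rl_maxima_def by blast
  then have j: "j \<in> {1..n}" "\<And>l. l \<in> {1..n} \<Longrightarrow> j < l \<Longrightarrow> \<sigma> l < \<sigma> j"
    "\<And>l. l \<in> {1..n} \<Longrightarrow> l < j \<Longrightarrow> \<sigma> j \<le> \<sigma> l"
    unfolding nontrivial_rl_maxima_def rl_maxima_def by (blast, blast, fastforce)
  have lt: "\<sigma> j < \<sigma> l" if "l \<in> {1..n}" "l < j" for l
    using j(3)[OF that] perms_inj[OF \<sigma>, of j l] that by (simp add: order_less_le)
  have "skew_cut n \<sigma> j"
    unfolding skew_cut_def
  proof (intro conjI allI impI)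
    fix x y assume "1 \<le> x" "x \<le> j" "j < y" "y \<le> n"
    then have "\<sigma> j \<le> \<sigma> x" "\<sigma> y < \<sigma> j" using j lt[of x] by (cases "x = j"; fastforce)+
    then show "\<sigma> y < \<sigma> x" by simp
  qed (use j in simp)
  moreover have "skew_cut n \<sigma> (j - 1)"
    unfolding skew_cut_def
  proof (intro conjI allI impI)
    fix x y assume "1 \<le> x" "x \<le> j - 1" "j - 1 < y" "y \<le> n"
    then have "\<sigma> j < \<sigma> x" "\<sigma> y \<le> \<sigma> j" using j(1) j(2)[of y] lt[of x] by (cases "y = j"; fastforce)+
    then show "\<sigma> y < \<sigma> x" by simp
  qed (use j in auto)
  ultimately have "j = 0 \<or> j = n" "j - 1 = 0 \<or> j - 1 = n"
    using skew_cut_indecomposable[OF assms(1)] by blast+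
  then show False using j(1) assms(2) by auto
qed

lemma comp_poly_rl_maxima:
  "comp_poly (\<lambda>n \<sigma>. card (rl_maxima n \<sigma>)) n 1 =
    comp_poly (\<lambda>n \<sigma>. card (nontrivial_rl_maxima n \<sigma>)) n 1 + (if n = 1 then monom 1 1 - 1 else 0)"
proof (cases "n = 1")
  case True
  have "components 1 id = 1"
    using components_pos[of 1 id] components_le[of 1 id] by simp
  then have "{\<sigma> \<in> perms 1. components 1 \<sigma> = 1} = {id}"
    by (auto simp: permutes_id)
  moreover have "rl_maxima 1 id = {1}" "nontrivial_rl_maxima 1 id = {}"
    by (auto simp: rl_maxima_def nontrivial_rl_maxima_def)
  ultimately show ?thesis
    unfolding comp_poly_def True by (simp add: one_pCons monom_0)
next
  case False
  then show ?thesis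
    unfolding comp_poly_def
    by (auto intro!: sum.cong simp: nontrivial_rl_maxima_indecomposable simp del: One_nat_def)
qed

lemma component_recurrence_nontrivial_rl_maxima:
  "component_recurrence (\<lambda>n \<sigma>. card (nontrivial_rl_maxima n \<sigma>))"
  by (rule component_recurrence_transfer[OF skew_additive_nontrivial_rl_maxima
        skew_additive_rl_maxima stat_poly_rl_maxima_Suc comp_poly_rl_maxima])

section \<open>Mesh patterns that count these statistics\<close>

lemma mem_mesh12_occurrences:
  "(i, j) \<in> mesh12_occurrences R n \<sigma> \<longleftrightarrow> 1 \<le> i \<and> i < j \<and> j \<le> n \<and> \<sigma> i < \<sigma> j \<and>
     (\<forall>(x, y) \<in> R. \<forall>l. [0, i, j, n + 1] ! x < l \<longrightarrow> l < [0, i, j, n + 1] ! (x + 1) \<longrightarrow>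
        [0, \<sigma> i, \<sigma> j, n + 1] ! y < \<sigma> l \<longrightarrow> \<sigma> l < [0, \<sigma> i, \<sigma> j, n + 1] ! (y + 1) \<longrightarrow> False)"
  unfolding mesh12_occurrences_def Let_def mem_Collect_eq split_conv
  by (intro conj_cong refl) blast

text \<open>
  The shaded cells constrain the letters strictly between the positions of an occurrence; this lemma
  and the next one join two neighbouring cells of a row into one condition. The letters of the
  occurrence themselves satisfy it trivially.
\<close>

lemma all_less_split:
  fixes i j :: nat
  assumes "Suc 0 \<le> i" "i < j"
  shows "(\<forall>l. Suc 0 \<le> l \<longrightarrow> l < j \<longrightarrow> P l) \<longleftrightarrow>
    (\<forall>l. 0 < l \<longrightarrow> l < i \<longrightarrow> P l) \<and> P i \<and> (\<forall>l. i < l \<longrightarrow> l < j \<longrightarrow> P l)"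
proof (intro iffI conjI allI impI)
  fix l assume h: "(\<forall>l. 0 < l \<longrightarrow> l < i \<longrightarrow> P l) \<and> P i \<and> (\<forall>l. i < l \<longrightarrow> l < j \<longrightarrow> P l)"
    "Suc 0 \<le> l" "l < j"
  then show "P l" by (cases l i rule: linorder_cases) auto
qed (use assms in auto)

lemma all_greater_split:
  fixes i j :: nat
  assumes "i < j" "j \<le> n"
  shows "(\<forall>l. i < l \<longrightarrow> l \<le> n \<longrightarrow> P l) \<longleftrightarrow>
    (\<forall>l. i < l \<longrightarrow> l < j \<longrightarrow> P l) \<and> P j \<and> (\<forall>l. j < l \<longrightarrow> l \<le> n \<longrightarrow> P l)"
proof (intro iffI conjI allI impI)
  fix l assume h: "(\<forall>l. i < l \<longrightarrow> l < j \<longrightarrow> P l) \<and> P j \<and> (\<forall>l. j < l \<longrightarrow> l \<le> n \<longrightarrow> P l)"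
    "i < l" "l \<le> n"
  then show "P l" by (cases l j rule: linorder_cases) auto
qed (use assms in auto)

lemma perms_bounds:
  assumes "\<sigma> \<in> perms n"
  shows "\<sigma> l \<le> n \<longleftrightarrow> l \<le> n" "0 < \<sigma> l \<longleftrightarrow> 0 < l" "n < \<sigma> l \<longleftrightarrow> n < l"
  using perms_range[OF assms, of l] permutes_not_in[of \<sigma> "{1..n}" l] assms
  by (cases "l \<in> {1..n}"; auto)+

lemma mesh12_occurrences_range:
  "mesh12_occurrences R n \<sigma> \<subseteq> {1..n} \<times> {1..n}"
  unfolding mesh12_occurrences_def by auto

lemma ex_argmax:
  fixes \<sigma> :: "nat \<Rightarrow> nat"
  assumes "finite A" "A \<noteq> {}"
  shows "\<exists>x\<in>A. \<forall>y\<in>A. \<sigma> y \<le> \<sigma> x"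
proof -
  have "Max (\<sigma> ` A) \<in> \<sigma> ` A" using assms by (intro Max_in) auto
  then obtain x where "x \<in> A" "\<sigma> x = Max (\<sigma> ` A)" by auto
  then show ?thesis using assms(1) by (intro bexI[of _ x]) auto
qed

lemma ex_argmin:
  fixes \<sigma> :: "nat \<Rightarrow> nat"
  assumes "finite A" "A \<noteq> {}"
  shows "\<exists>x\<in>A. \<forall>y\<in>A. \<sigma> x \<le> \<sigma> y"
proof -
  have "Min (\<sigma> ` A) \<in> \<sigma> ` A" using assms by (intro Min_in) auto
  then obtain x where "x \<in> A" "\<sigma> x = Min (\<sigma> ` A)" by auto
  then show ?thesis using assms(1) by (intro bexI[of _ x]) auto
qed

lemma rl_maxima_iff:
  assumes "\<sigma> \<in> perms n"
  shows "j \<in> rl_maxima n \<sigma> \<longleftrightarrow> 1 \<le> j \<and> j \<le> n \<and> (\<forall>l. j < l \<longrightarrow> l \<le> n \<longrightarrow> \<sigma> l \<le> \<sigma> j)"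
proof
  assume h: "1 \<le> j \<and> j \<le> n \<and> (\<forall>l. j < l \<longrightarrow> l \<le> n \<longrightarrow> \<sigma> l \<le> \<sigma> j)"
  show "j \<in> rl_maxima n \<sigma>"
    unfolding rl_maxima_def
  proof (intro CollectI conjI ballI impI)
    fix l assume "l \<in> {1..n}" "j < l"
    then show "\<sigma> l < \<sigma> j"
      using h perms_inj[OF assms, of j l] by (simp add: order_less_le)
  qed (use h in simp)
qed (fastforce simp: rl_maxima_def)

lemma card_eq_nontrivial_rl_maxima:
  assumes mem: "\<And>i j. (i, j) \<in> M \<Longrightarrow> 1 \<le> i \<and> i < j \<and> \<sigma> i < \<sigma> j \<and> j \<in> rl_maxima n \<sigma>"
    and unique: "\<And>i i' j. (i, j) \<in> M \<Longrightarrow> (i', j) \<in> M \<Longrightarrow> i = i'"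
    and ex: "\<And>j k. j \<in> rl_maxima n \<sigma> \<Longrightarrow> 1 \<le> k \<Longrightarrow> k < j \<Longrightarrow> \<sigma> k < \<sigma> j \<Longrightarrow> \<exists>i. (i, j) \<in> M"
  shows "card M = card (nontrivial_rl_maxima n \<sigma>)"
proof -
  have "inj_on snd M"
  proof (rule inj_onI)
    fix p q assume "p \<in> M" "q \<in> M" "snd p = snd q"
    then show "p = q" using unique by (cases p, cases q) auto
  qed
  moreover have "snd ` M = nontrivial_rl_maxima n \<sigma>"
  proof
    show "snd ` M \<subseteq> nontrivial_rl_maxima n \<sigma>"
    proof
      fix j assume "j \<in> snd ` M"
      then obtain i where "(i, j) \<in> M" by auto
      then have "1 \<le> i" "i < j" "\<sigma> i < \<sigma> j" "j \<in> rl_maxima n \<sigma>" using mem by blast+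
      then show "j \<in> nontrivial_rl_maxima n \<sigma>"
        by (auto simp: nontrivial_rl_maxima_def rl_maxima_def intro!: bexI[of _ i])
    qed
    show "nontrivial_rl_maxima n \<sigma> \<subseteq> snd ` M"
    proof
      fix j assume "j \<in> nontrivial_rl_maxima n \<sigma>"
      then obtain k where "j \<in> rl_maxima n \<sigma>" "1 \<le> k" "k < j" "\<sigma> k < \<sigma> j"
        by (auto simp: nontrivial_rl_maxima_def)
      then obtain i where "(i, j) \<in> M" using ex by blast
      then show "j \<in> snd ` M" by force
    qed
  qed
  ultimately show ?thesis by (metis card_image)
qed

text \<open>
  The shading forces \<open>j\<close> to be a right-to-left maximum and \<open>\<sigma> i\<close> to be the largest among the
  letters before \<open>j\<close> that are smaller than \<open>\<sigma> j\<close>.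
\<close>

lemma card_occurrences_nearest_smaller_letter:
  assumes \<sigma>: "\<sigma> \<in> perms n"
  shows "card (mesh12_occurrences {(2,2), (0,1), (1,1)} n \<sigma>) = card (nontrivial_rl_maxima n \<sigma>)"
proof -
  let ?M = "mesh12_occurrences {(2,2), (0,1), (1,1)} n \<sigma>"
  have mem: "(i, j) \<in> ?M \<longleftrightarrow> 1 \<le> i \<and> i < j \<and> \<sigma> i < \<sigma> j \<and> j \<in> rl_maxima n \<sigma> \<and>
      (\<forall>l. 1 \<le> l \<longrightarrow> l < j \<longrightarrow> \<sigma> l < \<sigma> j \<longrightarrow> \<sigma> l \<le> \<sigma> i)" for i j
  proof (cases "1 \<le> i \<and> i < j \<and> j \<le> n \<and> \<sigma> i < \<sigma> j")
    case True
    \<comment> \<open>from the two middle-row cells to maximality of \<open>\<sigma> i\<close> below \<open>\<sigma> j\<close>\<close>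
    have contra: "(\<sigma> l < \<sigma> j \<longrightarrow> \<sigma> l \<le> \<sigma> i) \<longleftrightarrow> (\<sigma> i < \<sigma> l \<longrightarrow> \<sigma> j \<le> \<sigma> l)" for l
      by auto
    have "(i, j) \<in> ?M \<longleftrightarrow> (\<forall>l. j < l \<longrightarrow> l \<le> n \<longrightarrow> \<sigma> l \<le> \<sigma> j) \<and>
        (\<forall>l. 0 < l \<longrightarrow> l < i \<longrightarrow> \<sigma> l < \<sigma> j \<longrightarrow> \<sigma> l \<le> \<sigma> i) \<and>
        (\<forall>l. i < l \<longrightarrow> l < j \<longrightarrow> \<sigma> l < \<sigma> j \<longrightarrow> \<sigma> l \<le> \<sigma> i)"
      unfolding contra
      using True unfolding mem_mesh12_occurrences
      by (simp add: numeral_2_eq_2 less_Suc_eq_le perms_bounds[OF \<sigma>] not_less Suc_le_eq)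
    then show ?thesis
      using True by (simp add: all_less_split[of i j] rl_maxima_iff[OF \<sigma>])
  next
    case False
    then show ?thesis by (auto simp: mem_mesh12_occurrences rl_maxima_iff[OF \<sigma>])
  qed
  show ?thesis
  proof (rule card_eq_nontrivial_rl_maxima)
    show "1 \<le> i \<and> i < j \<and> \<sigma> i < \<sigma> j \<and> j \<in> rl_maxima n \<sigma>" if "(i, j) \<in> ?M" for i j
      using that unfolding mem by blast
    show "i = i'" if "(i, j) \<in> ?M" "(i', j) \<in> ?M" for i i' j
    proof -
      have "\<sigma> i = \<sigma> i'" using that unfolding mem by (meson le_antisym)
      then show ?thesis using perms_inj[OF \<sigma>] by simp
    qed
    show "\<exists>i. (i, j) \<in> ?M"
      if "j \<in> rl_maxima n \<sigma>" "1 \<le> k" "k < j" "\<sigma> k < \<sigma> j" for j k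
    proof -
      let ?A = "{l. 1 \<le> l \<and> l < j \<and> \<sigma> l < \<sigma> j}"
      have "finite ?A" "?A \<noteq> {}" using that by auto
      then obtain i where "i \<in> ?A" "\<forall>l\<in>?A. \<sigma> l \<le> \<sigma> i" using ex_argmax by blast
      then have "(i, j) \<in> ?M" using that unfolding mem by auto
      then show ?thesis by blast
    qed
  qed
qed

text \<open>
  The shading forces \<open>j\<close> to be a right-to-left maximum and \<open>\<sigma> i\<close> to be the smallest letter before
  \<open>j\<close>.
\<close>

lemma card_occurrences_prefix_minimum:
  assumes \<sigma>: "\<sigma> \<in> perms n"
  shows "card (mesh12_occurrences {(2,2), (0,0), (1,0)} n \<sigma>) = card (nontrivial_rl_maxima n \<sigma>)"
proof -
  let ?M = "mesh12_occurrences {(2,2), (0,0), (1,0)} n \<sigma>"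
  have mem: "(i, j) \<in> ?M \<longleftrightarrow> 1 \<le> i \<and> i < j \<and> \<sigma> i < \<sigma> j \<and> j \<in> rl_maxima n \<sigma> \<and>
      (\<forall>l. 1 \<le> l \<longrightarrow> l < j \<longrightarrow> \<sigma> i \<le> \<sigma> l)" for i j
  proof (cases "1 \<le> i \<and> i < j \<and> j \<le> n \<and> \<sigma> i < \<sigma> j")
    case True
    have "(i, j) \<in> ?M \<longleftrightarrow> (\<forall>l. j < l \<longrightarrow> l \<le> n \<longrightarrow> \<sigma> l \<le> \<sigma> j) \<and>
        (\<forall>l. 0 < l \<longrightarrow> l < i \<longrightarrow> \<sigma> i \<le> \<sigma> l) \<and> (\<forall>l. i < l \<longrightarrow> l < j \<longrightarrow> \<sigma> i \<le> \<sigma> l)"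
      using True unfolding mem_mesh12_occurrences
      by (simp add: numeral_2_eq_2 less_Suc_eq_le perms_bounds[OF \<sigma>] not_less Suc_le_eq)
    then show ?thesis
      using True by (simp add: all_less_split[of i j] rl_maxima_iff[OF \<sigma>])
  next
    case False
    then show ?thesis by (auto simp: mem_mesh12_occurrences rl_maxima_iff[OF \<sigma>])
  qed
  show ?thesis
  proof (rule card_eq_nontrivial_rl_maxima)
    show "1 \<le> i \<and> i < j \<and> \<sigma> i < \<sigma> j \<and> j \<in> rl_maxima n \<sigma>" if "(i, j) \<in> ?M" for i j
      using that unfolding mem by blast
    show "i = i'" if "(i, j) \<in> ?M" "(i', j) \<in> ?M" for i i' j
    proof -
      have "\<sigma> i = \<sigma> i'" using that unfolding mem by (meson le_antisym)
      then show ?thesis using perms_inj[OF \<sigma>] by simp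
    qed
    show "\<exists>i. (i, j) \<in> ?M"
      if "j \<in> rl_maxima n \<sigma>" "1 \<le> k" "k < j" "\<sigma> k < \<sigma> j" for j k
    proof -
      let ?A = "{l. 1 \<le> l \<and> l < j}"
      have "finite ?A" "?A \<noteq> {}" using that by auto
      then obtain i where i: "i \<in> ?A" "\<forall>l\<in>?A. \<sigma> i \<le> \<sigma> l" using ex_argmin by blast
      then have "\<sigma> i \<le> \<sigma> k" using that by blast
      then have "(i, j) \<in> ?M" using i that unfolding mem by auto
      then show ?thesis by blast
    qed
  qed
qed

text \<open>
  The shading forces \<open>\<sigma> j\<close> to be the maximum from position \<open>i\<close> onwards, so \<open>i\<close> determines \<open>j\<close>.
\<close>

lemma card_occurrences_suffix_maximum:
  assumes \<sigma>: "\<sigma> \<in> perms n"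
  shows "card (mesh12_occurrences {(1,2), (2,2), (0,1)} n \<sigma>) = card (unobstructed_climbs n \<sigma>)"
proof -
  let ?M = "mesh12_occurrences {(1,2), (2,2), (0,1)} n \<sigma>"
  have mem: "(i, j) \<in> ?M \<longleftrightarrow> i \<in> {1..n} \<and> j \<in> {1..n} \<and> i < j \<and> \<sigma> i < \<sigma> j \<and>
     (\<forall>l\<in>{1..n}. i < l \<longrightarrow> \<sigma> l \<le> \<sigma> j) \<and> (\<forall>l\<in>{1..n}. l < i \<longrightarrow> \<sigma> i < \<sigma> l \<longrightarrow> \<sigma> j \<le> \<sigma> l)" for i j
  proof (cases "1 \<le> i \<and> i < j \<and> j \<le> n \<and> \<sigma> i < \<sigma> j")
    case True
    have "(i, j) \<in> ?M \<longleftrightarrow> (\<forall>l. i < l \<longrightarrow> l < j \<longrightarrow> \<sigma> l \<le> \<sigma> j) \<and>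
        (\<forall>l. j < l \<longrightarrow> l \<le> n \<longrightarrow> \<sigma> l \<le> \<sigma> j) \<and>
        (\<forall>l. 0 < l \<longrightarrow> l < i \<longrightarrow> \<sigma> i < \<sigma> l \<longrightarrow> \<sigma> j \<le> \<sigma> l)"
      using True unfolding mem_mesh12_occurrences
      by (simp add: numeral_2_eq_2 less_Suc_eq_le perms_bounds[OF \<sigma>] not_less Suc_le_eq)
    also have "\<dots> \<longleftrightarrow> (\<forall>l. i < l \<longrightarrow> l \<le> n \<longrightarrow> \<sigma> l \<le> \<sigma> j) \<and>
        (\<forall>l. 0 < l \<longrightarrow> l < i \<longrightarrow> \<sigma> i < \<sigma> l \<longrightarrow> \<sigma> j \<le> \<sigma> l)"
      using True by (simp add: all_greater_split[of i j n])
    finally show ?thesis using True by auto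
  next
    case False
    then show ?thesis by (auto simp: mem_mesh12_occurrences)
  qed
  have "inj_on fst ?M"
  proof (rule inj_onI)
    fix p q assume "p \<in> ?M" "q \<in> ?M" "fst p = fst q"
    then obtain i j j' where p: "p = (i, j)" "q = (i, j')" "(i, j) \<in> ?M" "(i, j') \<in> ?M"
      by (cases p, cases q) auto
    then have "\<sigma> j = \<sigma> j'" unfolding mem by (meson le_antisym)
    then show "p = q" using p perms_inj[OF \<sigma>] by simp
  qed
  moreover have "fst ` ?M = unobstructed_climbs n \<sigma>"
  proof (intro set_eqI)
    fix i
    have "i \<in> fst ` ?M \<longleftrightarrow> (\<exists>j. (i, j) \<in> ?M)" by force
    then show "i \<in> fst ` ?M \<longleftrightarrow> i \<in> unobstructed_climbs n \<sigma>"
      unfolding mem unobstructed_climbs_def by blast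
  qed
  ultimately show ?thesis by (metis card_image)
qed

section \<open>Symmetries of mesh patterns\<close>

lemma satisfies_recurrences_symmetry:
  assumes perm: "\<And>n \<sigma>. \<sigma> \<in> perms n \<Longrightarrow> \<phi> n \<sigma> \<in> perms n"
    and invol: "\<And>n \<sigma>. \<sigma> \<in> perms n \<Longrightarrow> \<phi> n (\<phi> n \<sigma>) = \<sigma>"
    and occ: "\<And>n \<sigma>. \<sigma> \<in> perms n \<Longrightarrow>
      card (mesh12_occurrences R' n (\<phi> n \<sigma>)) = card (mesh12_occurrences R n \<sigma>)"
    and comp: "\<And>n \<sigma>. \<sigma> \<in> perms n \<Longrightarrow> components n (\<phi> n \<sigma>) = components n \<sigma>"
    and R: "satisfies_recurrences R"
  shows "satisfies_recurrences R'"
proof -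
  have bij: "bij_betw (\<phi> n) {\<sigma> \<in> perms n. P (card (mesh12_occurrences R n \<sigma>)) (components n \<sigma>)}
      {\<sigma> \<in> perms n. P (card (mesh12_occurrences R' n \<sigma>)) (components n \<sigma>)}" for n P
  proof (rule bij_betw_byWitness[where f' = "\<phi> n"])
    have occ_inv: "card (mesh12_occurrences R n (\<phi> n \<sigma>)) = card (mesh12_occurrences R' n \<sigma>)"
      if "\<sigma> \<in> perms n" for \<sigma>
      using occ[OF perm[OF that]] invol[OF that] by simp
    show "\<phi> n ` {\<sigma> \<in> perms n. P (card (mesh12_occurrences R' n \<sigma>)) (components n \<sigma>)} \<subseteq>
        {\<sigma> \<in> perms n. P (card (mesh12_occurrences R n \<sigma>)) (components n \<sigma>)}"
      using occ_inv comp perm by auto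
  qed (use invol occ comp perm in auto)
  have "s_occ R' n k = s_occ R n k" for n k
    using bij_betw_same_card[OF bij[of n "\<lambda>c h. int c = k"]] by (simp add: s_occ_def)
  moreover have "s_adm R' n k h = s_adm R n k h" for n k h
    using bij_betw_same_card[OF bij[of n "\<lambda>c h'. int c = k \<and> int h' = h"]]
    by (simp add: s_adm_components)
  ultimately show ?thesis
    using R by (simp add: satisfies_recurrences_def)
qed

text \<open>
  Inverse and reverse-complement both turn a cut after \<open>c\<close> positions into a cut after \<open>n - c\<close>
  positions.
\<close>

lemma components_eq_by_reflection:
  assumes "\<And>c. c \<le> n \<Longrightarrow> skew_cut n \<tau> (n - c) \<longleftrightarrow> skew_cut n \<sigma> c"
  shows "components n \<tau> = components n \<sigma>"
proof -
  have "bij_betw (\<lambda>c. n - c) {c. skew_cut n \<sigma> c} {c. skew_cut n \<tau> c}"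
  proof (rule bij_betw_byWitness[where f' = "\<lambda>c. n - c"])
    show "(\<lambda>c. n - c) ` {c. skew_cut n \<tau> c} \<subseteq> {c. skew_cut n \<sigma> c}"
      using assms skew_cut_le[of n \<tau>] by (auto simp flip: assms)
  qed (use assms skew_cut_le in \<open>auto dest: skew_cut_le\<close>)
  then have "card {c. skew_cut n \<tau> c} = card {c. skew_cut n \<sigma> c}"
    by (simp add: bij_betw_same_card)
  then show ?thesis by (simp add: card_skew_cuts)
qed

lemma perms_inv: "\<sigma> \<in> perms n \<Longrightarrow> inv \<sigma> \<in> perms n"
  by (simp add: permutes_inv)

lemma perms_inv_apply:
  assumes "\<sigma> \<in> perms n"
  shows "\<sigma> (inv \<sigma> l) = l" "inv \<sigma> (\<sigma> l) = l"
  using permutes_inverses[of \<sigma> "{1..n}"] assms by auto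

lemma components_inv:
  assumes \<sigma>: "\<sigma> \<in> perms n"
  shows "components n (inv \<sigma>) = components n \<sigma>"
proof (rule components_eq_by_reflection)
  have imp: "skew_cut n (inv \<tau>) (n - c)" if \<tau>: "\<tau> \<in> perms n" and "c \<le> n" "skew_cut n \<tau> c" for \<tau> c
  proof -
    have cut: "1 \<le> x \<Longrightarrow> x \<le> n \<Longrightarrow> x \<le> c \<longleftrightarrow> n - c < \<tau> x" for x
      using that skew_cut_iff[OF \<tau>, of c] by blast
    have "x \<le> n - c \<longleftrightarrow> n - (n - c) < inv \<tau> x" if "1 \<le> x" "x \<le> n" for x
      using cut[of "inv \<tau> x"] perms_range[OF perms_inv[OF \<tau>], of x] perms_inv_apply[OF \<tau>] that \<open>c \<le> n\<close>
      by auto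
    then show ?thesis
      using skew_cut_iff[OF perms_inv[OF \<tau>], of "n - c"] by simp
  qed
  fix c assume "c \<le> n"
  moreover have "inv (inv \<sigma>) = \<sigma>" using \<sigma> permutes_inv_inv by blast
  ultimately show "skew_cut n (inv \<sigma>) (n - c) \<longleftrightarrow> skew_cut n \<sigma> c"
    using imp[OF \<sigma>, of c] imp[OF perms_inv[OF \<sigma>], of "n - c"] by auto
qed

text \<open>
  Positions and values change roles: an occurrence at positions \<open>(i, j)\<close> becomes one at positions
  \<open>(\<sigma> i, \<sigma> j)\<close>, and the cells are reflected in the diagonal.
\<close>

lemma card_mesh12_occurrences_inv:
  assumes \<sigma>: "\<sigma> \<in> perms n"
  shows "card (mesh12_occurrences (prod.swap ` R) n (inv \<sigma>)) = card (mesh12_occurrences R n \<sigma>)"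
proof -
  have imp: "(\<tau> i, \<tau> j) \<in> mesh12_occurrences (prod.swap ` S) n (inv \<tau>)"
    if \<tau>: "\<tau> \<in> perms n" and h: "(i, j) \<in> mesh12_occurrences S n \<tau>" for \<tau> S i j
  proof -
    have ij: "1 \<le> i" "i < j" "j \<le> n" "\<tau> i < \<tau> j"
      using h by (auto simp: mem_mesh12_occurrences)
    then have "1 \<le> \<tau> i" "\<tau> j \<le> n"
      using perms_range[OF \<tau>, of i] perms_range[OF \<tau>, of j] by auto
    moreover have False
      if "(x, y) \<in> S" "[0, \<tau> i, \<tau> j, n + 1] ! y < l" "l < [0, \<tau> i, \<tau> j, n + 1] ! (y + 1)"
        "[0, i, j, n + 1] ! x < inv \<tau> l" "inv \<tau> l < [0, i, j, n + 1] ! (x + 1)" for x y l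
      using h that perms_inv_apply(1)[OF \<tau>, of l]
      unfolding mem_mesh12_occurrences by fastforce
    ultimately show ?thesis
      using ij unfolding mem_mesh12_occurrences perms_inv_apply[OF \<tau>] by fastforce
  qed
  have bij: "bij_betw (\<lambda>(i, j). (\<sigma> i, \<sigma> j)) (mesh12_occurrences R n \<sigma>)
      (mesh12_occurrences (prod.swap ` R) n (inv \<sigma>))"
  proof (rule bij_betw_byWitness[where f' = "\<lambda>(i, j). (inv \<sigma> i, inv \<sigma> j)"])
    have eqs: "inv (inv \<sigma>) = \<sigma>" "prod.swap ` prod.swap ` R = R"
      using \<sigma> permutes_inv_inv by (blast, force simp: image_image)
    show "(\<lambda>(i, j). (inv \<sigma> i, inv \<sigma> j)) ` mesh12_occurrences (prod.swap ` R) n (inv \<sigma>) \<subseteq>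
        mesh12_occurrences R n \<sigma>"
      using imp[OF perms_inv[OF \<sigma>], of _ _ "prod.swap ` R"] unfolding eqs by auto
    show "(\<lambda>(i, j). (\<sigma> i, \<sigma> j)) ` mesh12_occurrences R n \<sigma> \<subseteq>
        mesh12_occurrences (prod.swap ` R) n (inv \<sigma>)"
      using imp[OF \<sigma>] by auto
  qed (auto simp: perms_inv_apply[OF \<sigma>])
  then show ?thesis by (simp add: bij_betw_same_card)
qed

lemma satisfies_recurrences_swap:
  assumes "satisfies_recurrences R"
  shows "satisfies_recurrences (prod.swap ` R)"
proof (rule satisfies_recurrences_symmetry[where \<phi> = "\<lambda>n. inv" and R = R])
  show "inv (inv \<sigma>) = \<sigma>" if "\<sigma> \<in> perms n" for n \<sigma>
    using that permutes_inv_inv by blast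
qed (use assms perms_inv components_inv card_mesh12_occurrences_inv in auto)

definition reverse_complement :: "nat \<Rightarrow> (nat \<Rightarrow> nat) \<Rightarrow> nat \<Rightarrow> nat" where
  "reverse_complement n \<sigma> l = (if 1 \<le> l \<and> l \<le> n then n + 1 - \<sigma> (n + 1 - l) else l)"

lemma reverse_complement_perms:
  assumes \<sigma>: "\<sigma> \<in> perms n"
  shows "reverse_complement n \<sigma> \<in> perms n"
proof (rule permsI)
  have range: "1 \<le> \<sigma> (n + 1 - l) \<and> \<sigma> (n + 1 - l) \<le> n" if "1 \<le> l" "l \<le> n" for l
    using perms_range[OF \<sigma>, of "n + 1 - l"] that by auto
  show "inj_on (reverse_complement n \<sigma>) {1..n}"
  proof (rule inj_onI)
    fix x y assume xy: "x \<in> {1..n}" "y \<in> {1..n}" "reverse_complement n \<sigma> x = reverse_complement n \<sigma> y"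
    then have "n + 1 - \<sigma> (n + 1 - x) = n + 1 - \<sigma> (n + 1 - y)"
      by (simp add: reverse_complement_def)
    moreover have "\<sigma> (n + 1 - x) \<le> n" "\<sigma> (n + 1 - y) \<le> n"
      using range[of x] range[of y] xy by auto
    ultimately have "\<sigma> (n + 1 - x) = \<sigma> (n + 1 - y)" by linarith
    then show "x = y" using xy by (auto simp: perms_inj[OF \<sigma>])
  qed
  show "1 \<le> reverse_complement n \<sigma> x \<and> reverse_complement n \<sigma> x \<le> n" if "1 \<le> x" "x \<le> n" for x
    using range[OF that] that by (auto simp: reverse_complement_def)
qed (auto simp: reverse_complement_def)

lemma reverse_complement_involution:
  assumes \<sigma>: "\<sigma> \<in> perms n"
  shows "reverse_complement n (reverse_complement n \<sigma>) = \<sigma>"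
proof
  fix l
  show "reverse_complement n (reverse_complement n \<sigma>) l = \<sigma> l"
  proof (cases "l \<in> {1..n}")
    case True
    then have "1 \<le> n + 1 - l" "n + 1 - l \<le> n" "n + 1 - (n + 1 - l) = l" "\<sigma> l \<le> n"
      using perms_range[OF \<sigma>, of l] by auto
    then show ?thesis using True by (simp add: reverse_complement_def)
  next
    case False
    then show ?thesis
      using permutes_not_in[of \<sigma> "{1..n}" l] \<sigma> by (auto simp: reverse_complement_def)
  qed
qed

lemma components_reverse_complement:
  assumes \<sigma>: "\<sigma> \<in> perms n"
  shows "components n (reverse_complement n \<sigma>) = components n \<sigma>"
proof (rule components_eq_by_reflection)
  have imp: "skew_cut n (reverse_complement n \<tau>) (n - c)"
    if \<tau>: "\<tau> \<in> perms n" and "c \<le> n" "skew_cut n \<tau> c" for \<tau> c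
    unfolding skew_cut_def
  proof (intro conjI allI impI)
    fix x y assume xy: "1 \<le> x" "x \<le> n - c" "n - c < y" "y \<le> n"
    then have "1 \<le> n + 1 - y" "n + 1 - y \<le> c" "c < n + 1 - x" "n + 1 - x \<le> n"
      using \<open>c \<le> n\<close> by auto
    then have "\<tau> (n + 1 - x) < \<tau> (n + 1 - y)"
      using that(3) by (auto simp: skew_cut_def)
    moreover have "\<tau> (n + 1 - y) \<le> n" "\<tau> (n + 1 - x) \<le> n"
      using perms_range[OF \<tau>, of "n + 1 - y"] perms_range[OF \<tau>, of "n + 1 - x"] xy by auto
    ultimately show "reverse_complement n \<tau> y < reverse_complement n \<tau> x"
      using xy by (auto simp: reverse_complement_def)
  qed simp
  fix c assume "c \<le> n"
  then show "skew_cut n (reverse_complement n \<sigma>) (n - c) \<longleftrightarrow> skew_cut n \<sigma> c"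
    using imp[OF \<sigma>, of c] imp[OF reverse_complement_perms[OF \<sigma>], of "n - c"]
      reverse_complement_involution[OF \<sigma>] by auto
qed

definition rotate_cell :: "nat \<times> nat \<Rightarrow> nat \<times> nat" where
  "rotate_cell = (\<lambda>(x, y). (2 - x, 2 - y))"

text \<open>
  The diagram is rotated by a half-turn. The two grid lines that bound column \<open>x\<close> go to the lines
  that bound column \<open>2 - x\<close>, in the opposite order.
\<close>

lemma card_mesh12_occurrences_reverse_complement:
  assumes \<sigma>: "\<sigma> \<in> perms n" and R: "R \<subseteq> {0, 1, 2} \<times> {0, 1, 2}"
  shows "card (mesh12_occurrences (rotate_cell ` R) n (reverse_complement n \<sigma>)) =
    card (mesh12_occurrences R n \<sigma>)"
proof -
  have imp: "(n + 1 - j, n + 1 - i) \<in> mesh12_occurrences (rotate_cell ` S) n (reverse_complement n \<tau>)"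
    if \<tau>: "\<tau> \<in> perms n" and S: "S \<subseteq> {0, 1, 2} \<times> {0, 1, 2}"
      and h: "(i, j) \<in> mesh12_occurrences S n \<tau>" for \<tau> S i j
  proof -
    have ij: "1 \<le> i" "i < j" "j \<le> n" "\<tau> i < \<tau> j"
      using h by (auto simp: mem_mesh12_occurrences)
    have vals: "1 \<le> \<tau> i" "\<tau> j \<le> n"
      using perms_range[OF \<tau>, of i] perms_range[OF \<tau>, of j] ij by auto
    have rci: "reverse_complement n \<tau> (n + 1 - j) = n + 1 - \<tau> j"
      "reverse_complement n \<tau> (n + 1 - i) = n + 1 - \<tau> i"
      using ij by (auto simp: reverse_complement_def)
    \<comment> \<open>used for positions and for values alike\<close>
    have refl: "[0, n + 1 - b, n + 1 - a, n + 1] ! (2 - x) = n + 1 - [0, a, b, n + 1] ! (x + 1)"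
      "[0, n + 1 - b, n + 1 - a, n + 1] ! (2 - x + 1) = n + 1 - [0, a, b, n + 1] ! x"
      "[0, a, b, n + 1] ! (x + 1) \<le> n + 1"
      if "x \<in> {0, 1, 2}" "a < b" "b \<le> n" for a b x
      using that by (auto simp: numeral_2_eq_2)
    have False
      if xy: "(x, y) \<in> S"
        and l: "[0, n + 1 - j, n + 1 - i, n + 1] ! (2 - x) < l"
          "l < [0, n + 1 - j, n + 1 - i, n + 1] ! (2 - x + 1)"
        and v: "[0, n + 1 - \<tau> j, n + 1 - \<tau> i, n + 1] ! (2 - y) < reverse_complement n \<tau> l"
          "reverse_complement n \<tau> l < [0, n + 1 - \<tau> j, n + 1 - \<tau> i, n + 1] ! (2 - y + 1)" for x y l
    proof -
      have xy': "x \<in> {0, 1, 2}" "y \<in> {0, 1, 2}" using xy S by auto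
      note l = l[unfolded refl(1,2)[OF xy'(1) ij(2,3)]]
      note v = v[unfolded refl(1,2)[OF xy'(2) ij(4) vals(2)]]
      have l': "1 \<le> l" "l \<le> n" using l by auto
      then have rc: "reverse_complement n \<tau> l = n + 1 - \<tau> (n + 1 - l)"
        by (simp add: reverse_complement_def)
      have "[0, i, j, n + 1] ! x < n + 1 - l" "n + 1 - l < [0, i, j, n + 1] ! (x + 1)"
        using l l' refl(3)[OF xy'(1) ij(2,3)] by linarith+
      moreover have "[0, \<tau> i, \<tau> j, n + 1] ! y < \<tau> (n + 1 - l)"
        "\<tau> (n + 1 - l) < [0, \<tau> i, \<tau> j, n + 1] ! (y + 1)"
        using v refl(3)[OF xy'(2) ij(4) vals(2)] unfolding rc by linarith+
      ultimately show False using h xy unfolding mem_mesh12_occurrences by fast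
    qed
    then show ?thesis
      using ij vals unfolding mem_mesh12_occurrences rci rotate_cell_def by fastforce
  qed
  let ?f = "\<lambda>(i, j). (n + 1 - j, n + 1 - i)"
  have "bij_betw ?f (mesh12_occurrences R n \<sigma>)
      (mesh12_occurrences (rotate_cell ` R) n (reverse_complement n \<sigma>))"
  proof (rule bij_betw_byWitness[where f' = ?f])
    have "rotate_cell p \<in> {0, 1, 2} \<times> {0, 1, 2} \<and> rotate_cell (rotate_cell p) = p"
      if "p \<in> R" for p
    proof -
      obtain x y where p: "p = (x, y)" by (cases p)
      have "(x, y) \<in> {0, 1, 2} \<times> {0, 1, 2}" using R that p by blast
      then have "x \<in> {0, 1, 2}" "y \<in> {0, 1, 2}" by (simp_all only: mem_Sigma_iff)
      moreover have "2 - z \<in> {0, 1, 2} \<and> 2 - (2 - z) = z" if "z \<in> {0, 1, 2}" for z :: nat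
        using that by auto
      ultimately show ?thesis by (simp only: p rotate_cell_def split_conv mem_Sigma_iff)
    qed
    then have R': "rotate_cell ` R \<subseteq> {0, 1, 2} \<times> {0, 1, 2}"
      and "\<And>p. p \<in> R \<Longrightarrow> rotate_cell (rotate_cell p) = p"
      by blast+
    then have eqs: "rotate_cell ` rotate_cell ` R = R" by (force simp: image_image)
    show "?f ` mesh12_occurrences (rotate_cell ` R) n (reverse_complement n \<sigma>) \<subseteq>
        mesh12_occurrences R n \<sigma>"
      using imp[OF reverse_complement_perms[OF \<sigma>] R']
      unfolding eqs reverse_complement_involution[OF \<sigma>] by auto
    show "?f ` mesh12_occurrences R n \<sigma> \<subseteq>
        mesh12_occurrences (rotate_cell ` R) n (reverse_complement n \<sigma>)"
      using imp[OF \<sigma> R] by auto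
  qed (use mesh12_occurrences_range in \<open>fastforce+\<close>)
  then show ?thesis by (simp add: bij_betw_same_card)
qed

lemma satisfies_recurrences_rotate:
  assumes "satisfies_recurrences R" "R \<subseteq> {0, 1, 2} \<times> {0, 1, 2}"
  shows "satisfies_recurrences (rotate_cell ` R)"
  by (rule satisfies_recurrences_symmetry[where \<phi> = reverse_complement and R = R])
    (use assms reverse_complement_perms reverse_complement_involution components_reverse_complement
      card_mesh12_occurrences_reverse_complement in auto)

section \<open>The twelve patterns\<close>

lemma satisfies_recurrences_orbit:
  assumes "satisfies_recurrences R" "R \<subseteq> {0, 1, 2} \<times> {0, 1, 2}"
    and "R' \<in> {R, prod.swap ` R, rotate_cell ` R, rotate_cell ` prod.swap ` R}"
  shows "satisfies_recurrences R'"
proof -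
  have "prod.swap ` R \<subseteq> {0, 1, 2} \<times> {0, 1, 2}"
    using image_mono[OF assms(2), of prod.swap] by (simp only: product_swap)
  then have "satisfies_recurrences (rotate_cell ` prod.swap ` R)"
    by (rule satisfies_recurrences_rotate[OF satisfies_recurrences_swap[OF assms(1)]])
  then show ?thesis
    using assms(1,3) satisfies_recurrences_rotate[OF assms(1,2)]
      satisfies_recurrences_swap[OF assms(1)]
    by (elim insertE emptyE) simp_all
qed

theorem theorem1p8:
  fixes R :: "(nat \<times> nat) set"
  assumes "R \<in> {
      {(1,2), (2,2), (0,1)},
      {(1,2), (0,1), (0,0)},
      {(2,2), (2,1), (1,0)},
      {(2,1), (1,0), (0,0)},
      {(2,2), (0,1), (1,1)},
      {(1,2), (1,1), (0,0)},
      {(1,1), (2,1), (0,0)},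
      {(2,2), (1,1), (1,0)},
      {(1,2), (2,2), (0,0)},
      {(2,2), (0,1), (0,0)},
      {(2,2), (2,1), (0,0)},
      {(2,2), (0,0), (1,0)}}"
  shows
    "(\<forall>n. s_occ R n 0 = 1) \<and>
     (\<forall>k\<ge>1. s_occ R 0 k = 0) \<and>
     (\<forall>n>0. \<forall>k\<ge>0.
        int (s_occ R n k) =
          int n * int (s_occ R (n - 1) k)
          - (\<Sum>h = 1..int n - 1. h * int (s_adm R (n - 1) k h))
          + (\<Sum>h = 1..int n - 1. h * int (s_adm R (n - 1) (k - 1) h))) \<and>
     (\<forall>n\<ge>1. \<forall>k\<ge>0.
        int (s_adm R n k 1) =
          int (s_occ R n k) - (\<Sum>h = 2..int n. int (s_adm R n k h))) \<and>
     (\<forall>n\<ge>1. \<forall>k\<ge>0. \<forall>h\<ge>2.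
        s_adm R n k h =
          (\<Sum>i = 1..n - 1. \<Sum>a = 0..k. s_adm R i a 1 * s_adm R (n - i) (k - a) (h - 1))) \<and>
     s_adm R 0 0 0 = 1 \<and>
     (\<forall>k h. (k, h) \<noteq> (0, 0) \<longrightarrow> s_adm R 0 k h = 0) \<and>
     (\<forall>n\<ge>1. \<forall>k h. k \<notin> {0..int n - 1} \<or> h \<notin> {1..int n} \<longrightarrow> s_adm R n k h = 0)"
proof -
  let ?C = "{(1,2), (2,2), (0,1)} :: (nat \<times> nat) set"
  let ?M = "{(2,2), (0,1), (1,1)} :: (nat \<times> nat) set"
  let ?K = "{(2,2), (0,0), (1,0)} :: (nat \<times> nat) set"
  have C: "satisfies_recurrences ?C"
    by (rule satisfies_recurrences_by_statistic[OF card_occurrences_suffix_maximum skew_additive_unobstructed_climbs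
          component_recurrence_unobstructed_climbs])
  have M: "satisfies_recurrences ?M"
    by (rule satisfies_recurrences_by_statistic[OF card_occurrences_nearest_smaller_letter skew_additive_nontrivial_rl_maxima
          component_recurrence_nontrivial_rl_maxima])
  have K: "satisfies_recurrences ?K"
    by (rule satisfies_recurrences_by_statistic[OF card_occurrences_prefix_minimum skew_additive_nontrivial_rl_maxima
          component_recurrence_nontrivial_rl_maxima])
  have orbits:
    "prod.swap ` ?C = {(2,2), (2,1), (1,0)}" "rotate_cell ` ?C = {(2,1), (1,0), (0,0)}"
    "rotate_cell ` {(2,2), (2,1), (1,0)} = {(1,2), (0,1), (0,0)}"
    "prod.swap ` ?M = {(2,2), (1,1), (1,0)}" "rotate_cell ` ?M = {(1,1), (2,1), (0,0)}"
    "rotate_cell ` {(2,2), (1,1), (1,0)} = {(1,2), (1,1), (0,0)}"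
    "prod.swap ` ?K = {(2,2), (0,1), (0,0)}" "rotate_cell ` ?K = {(1,2), (2,2), (0,0)}"
    "rotate_cell ` {(2,2), (0,1), (0,0)} = {(2,2), (2,1), (0,0)}"
    by (simp_all add: rotate_cell_def insert_commute)
  have "R \<in> {?C, prod.swap ` ?C, rotate_cell ` ?C, rotate_cell ` prod.swap ` ?C} \<or>
    R \<in> {?M, prod.swap ` ?M, rotate_cell ` ?M, rotate_cell ` prod.swap ` ?M} \<or>
    R \<in> {?K, prod.swap ` ?K, rotate_cell ` ?K, rotate_cell ` prod.swap ` ?K}"
    using assms unfolding orbits
    by (elim insertE emptyE) (simp_all only: insert_iff simp_thms)
  moreover have "?C \<subseteq> {0, 1, 2} \<times> {0, 1, 2}" "?M \<subseteq> {0, 1, 2} \<times> {0, 1, 2}"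
    "?K \<subseteq> {0, 1, 2} \<times> {0, 1, 2}"
    by simp_all
  ultimately have "satisfies_recurrences R"
    using satisfies_recurrences_orbit[OF C] satisfies_recurrences_orbit[OF M]
      satisfies_recurrences_orbit[OF K] by (elim disjE) iprover+
  then show ?thesis
    unfolding satisfies_recurrences_def .
qed

end
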